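(* For every graph $G$ and integer $k\geq\mathrm{tw}(G)$, $G$ has a slick tree-decomposition with width at most $56k+58$ and order at most $\max\{\frac{|V(G)|}{14k+14},1\}$.
   Context: Graphs are simple, undirected and finite. For a non-empty tree $T$, a $T$-decomposition of a graph $G$ is a collection $(B_x:x\in V(T))$ of subsets $B_x\subseteq V(G)$ such that for each edge $vw\in E(G)$ some bag contains both $v$ and $w$, and for each $v\in V(G)$ the set $\{x\in V(T):v\in B_x\}$ induces a non-empty connected subtree of $T$. Its width is $\max_x|B_x|-1$ and its order is $|V(T)|$; $\mathrm{tw}(G)$ is the minimum width of a tree-decomposition of $G$. A tree-decomposition is rooted if $T$ is rooted. A rooted tree-decomposition $(B_x:x\in V(T))$ is slick if for each edge $xy\in E(T)$ with $x$ the parent of $y$, and each vertex $v\in B_x\cap B_y$, we have $(N_G(v)\cap B_y)\setminus B_x\neq\emptyset$. *)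

theory Defs
  imports Complex_Main "Graph_Theory.Digraph_Component"
begin

text \<open>
  A finite simple undirected graph is a \<^locale>\<open>pair_graph\<close>: a finite, loop-free digraph without
  parallel arcs whose arc set is symmetric. An undirected edge is a pair of opposite arcs.
\<close>

text \<open>
  The library constants \<^term>\<open>forest\<close> and \<^term>\<open>tree\<close> forbid every directed cycle. In a symmetric
  digraph the walk back and forth along an edge is such a cycle, so undirected acyclicity has
  to be restricted to cycles of length at least three. Connectedness includes non-emptiness.
\<close>

definition undirected_tree :: "'t pair_pre_digraph \<Rightarrow> bool" where
  "undirected_tree T \<longleftrightarrow>
     pair_graph T \<and> connected (with_proj T) \<and>
     \<not> (\<exists>p. pre_digraph.cycle (with_proj T) p \<and> 3 \<le> length p)"

definition tree_decomposition ::
  "'a pair_pre_digraph \<Rightarrow> 't pair_pre_digraph \<Rightarrow> ('t \<Rightarrow> 'a set) \<Rightarrow> bool" where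
  "tree_decomposition G T B \<longleftrightarrow>
     undirected_tree T \<and>
     (\<forall>x \<in> pverts T. B x \<subseteq> pverts G) \<and>
     (\<forall>(v, w) \<in> parcs G. \<exists>x \<in> pverts T. v \<in> B x \<and> w \<in> B x) \<and>
     (\<forall>v \<in> pverts G. connected (with_proj T \<restriction> {x \<in> pverts T. v \<in> B x}))"

text \<open>Widths are integers, since the graph without vertices has a decomposition of width \<open>-1\<close>.\<close>

definition decomposition_width :: "'t pair_pre_digraph \<Rightarrow> ('t \<Rightarrow> 'a set) \<Rightarrow> int" where
  "decomposition_width T B = (MAX x \<in> pverts T. int (card (B x))) - 1"

definition decomposition_order :: "'t pair_pre_digraph \<Rightarrow> nat" where
  "decomposition_order T = card (pverts T)"

text \<open>
  Every finite tree is isomorphic to one whose nodes are natural numbers, so the minimum may be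
  taken over these.
\<close>

definition treewidth :: "'a pair_pre_digraph \<Rightarrow> int" where
  "treewidth G =
     (LEAST w. \<exists>(T :: nat pair_pre_digraph) B.
        tree_decomposition G T B \<and> decomposition_width T B = w)"

text \<open>
  In a tree with root \<open>r\<close>, the parent of \<open>y\<close> is the vertex preceding \<open>y\<close> on the path from \<open>r\<close> to \<open>y\<close>.
\<close>

definition parent :: "'t pair_pre_digraph \<Rightarrow> 't \<Rightarrow> 't \<Rightarrow> 't \<Rightarrow> bool" where
  "parent T r x y \<longleftrightarrow> (\<exists>p. pre_digraph.apath (with_proj T) r (p @ [(x, y)]) y)"

definition rooted_tree_decomposition ::
  "'a pair_pre_digraph \<Rightarrow> 't pair_pre_digraph \<Rightarrow> 't \<Rightarrow> ('t \<Rightarrow> 'a set) \<Rightarrow> bool" where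
  "rooted_tree_decomposition G T r B \<longleftrightarrow> tree_decomposition G T B \<and> r \<in> pverts T"

definition slick_tree_decomposition ::
  "'a pair_pre_digraph \<Rightarrow> 't pair_pre_digraph \<Rightarrow> 't \<Rightarrow> ('t \<Rightarrow> 'a set) \<Rightarrow> bool" where
  "slick_tree_decomposition G T r B \<longleftrightarrow>
     rooted_tree_decomposition G T r B \<and>
     (\<forall>x y. (x, y) \<in> parcs T \<and> parent T r x y \<longrightarrow>
        (\<forall>v \<in> B x \<inter> B y. ((parcs G `` {v}) \<inter> B y) - B x \<noteq> {}))"

end

theory Submission
  imports Defs "HOL-Library.Countable"
begin

text \<open>
  Let \<open>K = k + 1\<close>. By induction, every set \<open>S\<close> with \<open>3 K \<le> |S| \<le> 14 K\<close> lies in the root bag of a slick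
  tree-decomposition whose root bag has at most \<open>2 |S| - 3 K\<close> vertices and whose bags have at most
  \<open>25 K\<close> vertices. If \<open>|S| \<le> 7 K\<close>, take \<open>S\<close> itself as the root bag; below it, decompose the graph that remains
  after deleting the vertices of \<open>S\<close> without neighbours outside \<open>S\<close>, with the remaining vertices of \<open>S\<close>
  and one outside neighbour of each in the root bag, which makes the new edge slick.
  If \<open>|S| > 7 K\<close>, split the graph along a separator of size exactly \<open>K\<close> that is balanced
  for \<open>S\<close>, and glue decompositions of both sides along their roots.

  Slickness survives merging two siblings and contracting an edge. Working upwards, children
  that bring fewer than \<open>14 K\<close> new vertices are merged with each other until they bring at least
  \<open>14 K\<close>, and what is left over is contracted into the parent. Bags grow by at most \<open>28 K\<close>, to
  \<open>53 K\<close>, and every remaining node brings at least \<open>14 K\<close> new vertices, as does the root when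
  \<open>|S| = 14 K\<close> initially.
\<close>

section \<open>Connectedness as reachability along arcs\<close>

lemma connected_with_proj_iff:
  assumes "sym (parcs T)" "parcs T \<subseteq> pverts T \<times> pverts T"
  shows "connected (with_proj T) \<longleftrightarrow>
    pverts T \<noteq> {} \<and> (\<forall>u \<in> pverts T. \<forall>v \<in> pverts T. (u, v) \<in> (parcs T)\<^sup>*)"
proof -
  \<comment> \<open>\<open>connected\<close> is strong connectivity of the symmetric closure, which
    adds no arcs here.\<close>
  have arcs: "parcs (mk_symmetric (with_proj T)) = parcs T"
    using assms(1) by (auto simp: parcs_mk_symmetric dest: symD)
  interpret S: pair_wf_digraph "mk_symmetric (with_proj T)"
    by unfold_locales (use assms(2) in \<open>auto simp: arcs\<close>)
  show ?thesis
    by (auto simp: connected_def strongly_connected_def S.reachable_conv' arcs)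
qed

lemma connected_induce_iff:
  assumes "sym (parcs T)"
  shows "connected (with_proj T \<restriction> C) \<longleftrightarrow>
    C \<noteq> {} \<and> (\<forall>u \<in> C. \<forall>v \<in> C. (u, v) \<in> (Restr (parcs T) C)\<^sup>*)"
proof -
  have "with_proj T \<restriction> C = with_proj \<lparr>pverts = C, parcs = Restr (parcs T) C\<rparr>"
    by (auto simp: with_proj_def induce_subgraph_def)
  then show ?thesis
    using assms by (simp add: connected_with_proj_iff sym_def)
qed

section \<open>Rooted trees\<close>

text \<open>The strictly decreasing \<open>rank\<close> replaces an acyclicity condition and is the
  measure for inductions towards the root.\<close>

locale rooted_tree =
  fixes T :: "'t pair_pre_digraph" and r :: 't and par :: "'t \<Rightarrow> 't" and rank :: "'t \<Rightarrow> nat"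
  assumes finite_nodes: "finite (pverts T)"
    and root_node: "r \<in> pverts T"
    and par_node: "x \<in> pverts T \<Longrightarrow> x \<noteq> r \<Longrightarrow> par x \<in> pverts T"
    and rank_par: "x \<in> pverts T \<Longrightarrow> x \<noteq> r \<Longrightarrow> rank (par x) < rank x"
    and arcs_eq: "parcs T = {(x, y). x \<in> pverts T - {r} \<and> y = par x \<or> y \<in> pverts T - {r} \<and> x = par y}"
begin

lemma arcsE:
  assumes "(x, y) \<in> parcs T"
  obtains (up) "x \<in> pverts T" "x \<noteq> r" "y = par x" | (down) "y \<in> pverts T" "y \<noteq> r" "x = par y"
  using assms by (auto simp: arcs_eq)

lemma arcs_sym: "sym (parcs T)"
  by (auto simp: arcs_eq sym_def)

lemma arcs_subset: "parcs T \<subseteq> pverts T \<times> pverts T"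
  by (auto simp: arcs_eq par_node)

lemma lower_arc:
  assumes "(x, y) \<in> parcs T" "rank y \<le> rank x"
  shows "y = par x"
  using assms(1) by (rule arcsE) (use assms(2) rank_par in fastforce)+

lemma pair_graph: "pair_graph T"
proof -
  have "finite (parcs T)"
    using arcs_subset finite_nodes by (meson finite_SigmaI finite_subset)
  then show ?thesis
    using arcs_subset finite_nodes arcs_sym rank_par
    by unfold_locales (fastforce simp: symmetric_def elim: arcsE)+
qed

sublocale pair_graph T by (rule pair_graph)

text \<open>Climbing from parent to parent stays inside \<open>C\<close> until it stops at the only
  top node, so all nodes of \<open>C\<close> are joined through that node.\<close>

lemma top_connected:
  assumes "C \<subseteq> pverts T" "\<exists>!x. x \<in> C \<and> (x = r \<or> par x \<notin> C)"
  shows "connected (with_proj T \<restriction> C)"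
proof -
  obtain m where m: "m \<in> C" "\<And>x. x \<in> C \<Longrightarrow> x \<noteq> r \<Longrightarrow> x \<noteq> m \<Longrightarrow> par x \<in> C" "m = r \<or> par m \<notin> C"
    using assms(2) by auto
  let ?R = "Restr (parcs T) C"
  have up: "(x, m) \<in> ?R\<^sup>*" if "x \<in> C" for x
    using that
  proof (induction "rank x" arbitrary: x rule: less_induct)
    case less
    show ?case
    proof (cases "x = m")
      case False
      then have "x \<noteq> r"
        using less.prems assms(2) m by blast
      then have "par x \<in> C" "rank (par x) < rank x" "(x, par x) \<in> ?R"
        using less.prems assms(1) m(2)[of x] False rank_par by (auto simp: arcs_eq)
      then show ?thesis
        using less.hyps by (meson converse_rtrancl_into_rtrancl)
    qed simp
  qed
  have "sym (?R\<^sup>*)"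
    using arcs_sym by (intro sym_rtrancl) (auto simp: sym_def)
  then have "(u, v) \<in> ?R\<^sup>*" if "u \<in> C" "v \<in> C" for u v
    using up[OF that(1)] up[OF that(2)] by (meson symD rtrancl_trans)
  then show ?thesis
    using m(1) by (auto simp: connected_induce_iff[OF arcs_sym])
qed

lemma connected: "connected (with_proj T)"
proof -
  have "with_proj T \<restriction> pverts T = with_proj T"
    using arcs_subset by (auto simp: with_proj_def induce_subgraph_def)
  moreover have "connected (with_proj T \<restriction> pverts T)"
    by (rule top_connected) (use root_node par_node in auto)
  ultimately show ?thesis by simp
qed

text \<open>On a cycle, both neighbours of a node of maximal rank would be its parent.\<close>

lemma no_long_cycle:
  assumes "cycle p" "3 \<le> length p"
  shows False
proof -
  obtain u where u: "awalk u p u" "distinct (tl (pawalk_verts u p))" "p \<noteq> []"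
    using assms(1) by (auto simp: cycle_def)
  define n where "n = length p"
  \<comment> \<open>The nodes of the cycle in cyclic order; consecutive values of \<open>h\<close>
    are joined by an arc.\<close>
  define h where "h i = snd (p ! (i mod n))" for i
  have n: "3 \<le> n" using assms(2) by (simp add: n_def)
  have "cas u p u" using u(1) by auto
  then have "pawalk_verts u p = fst (hd p) # map snd p"
    using awalk_verts_conv'[of u p u] u(3) by simp
  then have "distinct (map snd p)" using u(2) by simp
  then have inj: "h i = h j \<longleftrightarrow> i mod n = j mod n" for i j
    using nth_eq_iff_index_eq[of "map snd p" "i mod n" "j mod n"]
      mod_less_divisor[of n i] mod_less_divisor[of n j] n
    by (simp add: h_def flip: n_def)
  have cas_nth: "pcas a q b \<Longrightarrow> Suc i < length q \<Longrightarrow> fst (q ! Suc i) = snd (q ! i)" for a q b i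
  proof (induction q arbitrary: a i)
    case (Cons e es)
    then show ?case by (cases i; cases es) auto
  qed simp
  have step: "p ! (Suc i mod n) = (h i, h (Suc i))" for i
  proof -
    have "fst (p ! (Suc i mod n)) = snd (p ! (i mod n))"
    proof (cases "Suc (i mod n) = n")
      case True
      have "pcas u p u \<Longrightarrow> p \<noteq> [] \<Longrightarrow> fst (p ! 0) = u" by (cases p) auto
      moreover have "pcas a q b \<Longrightarrow> q \<noteq> [] \<Longrightarrow> snd (q ! (length q - 1)) = b" for a q b
        by (induction q arbitrary: a) (auto simp: nth_Cons')
      moreover have "Suc i mod n = 0" "i mod n = n - 1" using True by (auto simp: mod_Suc)
      ultimately show ?thesis using \<open>cas u p u\<close> u(3) by (metis n_def)
    next
      case False
      then have *: "Suc i mod n = Suc (i mod n)" "Suc (i mod n) < n"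
        using n mod_less_divisor[of n i] by (auto simp: mod_Suc simp del: mod_less_divisor)
      show ?thesis
        using cas_nth[of u p u "i mod n"] \<open>cas u p u\<close> * by (simp add: n_def)
    qed
    then show ?thesis by (simp add: h_def prod_eq_iff)
  qed
  have arc: "(h i, h (Suc i)) \<in> parcs T" for i
  proof -
    have "p ! (Suc i mod n) \<in> set p"
      using n mod_less_divisor[of n "Suc i"] by (intro nth_mem) (simp flip: n_def)
    then show ?thesis using u(1) step by (auto simp: awalk_def)
  qed
  obtain i where i: "i < n" "\<And>j. j < n \<Longrightarrow> rank (h j) \<le> rank (h i)"
  proof -
    have "Max ((\<lambda>j. rank (h j)) ` {..<n}) \<in> (\<lambda>j. rank (h j)) ` {..<n}"
      using n by (intro Max_in) (auto simp: lessThan_empty_iff)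
    then obtain i where "i < n" "Max ((\<lambda>j. rank (h j)) ` {..<n}) = rank (h i)" by auto
    then show ?thesis using that[of i] by (metis Max_ge finite_imageI finite_lessThan imageI lessThan_iff)
  qed
  have le: "rank (h j) \<le> rank (h i)" for j
    using i(2)[of "j mod n"] n by (simp add: h_def)
  \<comment> \<open>The cyclic predecessor of \<open>i\<close>, shifted by \<open>n\<close> to cover
    \<open>i = 0\<close>. It differs from the successor modulo \<open>n\<close> because
    \<open>n \<ge> 3\<close>.\<close>
  let ?k = "i + n - 1"
  have "Suc ?k = i + n" using n by simp
  then have hk: "h (Suc ?k) = h i" by (simp add: h_def)
  have "(h i, h ?k) \<in> parcs T" using arc[of ?k] hk arcs_sym by (metis symD)
  then have "h ?k = par (h i)" using le lower_arc by blast
  moreover have "h (Suc i) = par (h i)" using le lower_arc arc by blast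
  ultimately have "?k mod n = Suc i mod n" using inj by metis
  moreover have "?k mod n = (if i = 0 then n - 1 else i - 1)"
    using i(1) n by (auto simp: mod_if)
  moreover have "Suc i mod n = (if Suc i = n then 0 else Suc i)"
    using i(1) by simp
  ultimately show False using n by (auto split: if_splits)
qed

lemma undirected_tree: "undirected_tree T"
  using pair_graph connected no_long_cycle by (auto simp: undirected_tree_def)

text \<open>By induction, the arc before \<open>(x, y)\<close> starts at \<open>par x\<close>. If
  \<open>(x, y)\<close> went upwards, it would return to that node, which a simple path cannot
  do.\<close>

lemma apath_last_par:
  assumes "apath r (p @ [(x, y)]) y"
  shows "y \<in> pverts T - {r} \<and> x = par y"
  using assms
proof (induction p arbitrary: x y rule: rev_induct)
  case Nil
  then show ?case by (auto simp: apath_Cons_iff apath_Nil_iff elim!: arcsE)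
next
  case (snoc e p)
  obtain z w where e: "e = (z, w)" by (cases e)
  have last: "last (pawalk_verts r (p @ [e])) = w"
    by (simp add: awalk_verts_conv[simplified] e)
  have "apath r (p @ [e]) w" "apath w [(x, y)] y"
    "set (pawalk_verts r (p @ [e])) \<inter> set (tl (pawalk_verts w [(x, y)])) = {}"
    using snoc.prems unfolding apath_append_iff[of r "p @ [e]" "[(x, y)]" y] last by blast+
  then have w: "w = x" "apath r (p @ [(z, x)]) x" "(x, y) \<in> parcs T"
      "y \<notin> set (pawalk_verts r (p @ [(z, x)]))"
    by (auto simp: e apath_Cons_iff)
  have "z = par x" using snoc.IH[OF w(2)] by blast
  moreover have "z \<noteq> y" using w(4) by (auto simp: awalk_verts_conv[simplified])
  ultimately show ?case using w(3) by (auto elim: arcsE)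
qed

lemma parent_eq_par: "parent T r x y \<Longrightarrow> y \<in> pverts T - {r} \<and> x = par y"
  using apath_last_par by (auto simp: parent_def)

end

section \<open>Parents and ranks in an arbitrary tree\<close>

lemma rtrancl_leaves:
  assumes "(a, b) \<in> R\<^sup>*" "a \<in> A" "b \<notin> A"
  obtains x y where "(x, y) \<in> R" "x \<in> A" "y \<notin> A"
  using assms by (induction) auto

text \<open>A simple path of the digraph on \<open>A\<close> is also one of \<open>T\<close>. It
  will close a forbidden cycle through a node outside \<open>A\<close>.\<close>

lemma restr_apath:
  assumes "A \<subseteq> pverts T" "x \<in> A" "(x, y) \<in> (Restr (parcs T) A)\<^sup>*"
  obtains p where "pre_digraph.apath (with_proj T) x p y" "set (pawalk_verts x p) \<subseteq> A"
proof -
  define H where "H = \<lparr>pverts = A, parcs = Restr (parcs T) A\<rparr>"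
  interpret H: pair_wf_digraph H
    by unfold_locales (auto simp: H_def)
  have "(x, y) \<in> (parcs H)\<^sup>*" "x \<in> pverts H"
    using assms by (auto simp: H_def)
  then have "x \<rightarrow>\<^sup>*\<^bsub>with_proj H\<^esub> y"
    by (simp add: H.reachable_conv')
  then obtain p where p: "H.apath x p y"
    by (auto simp: H.reachable_apath)
  then have "H.awalk x p y" by (simp add: H.apath_def)
  then have "set (pawalk_verts x p) \<subseteq> A"
    by (rule H.awalkE') (simp add: H_def)
  moreover have "pre_digraph.apath (with_proj T) x p y"
    using p assms(1) by (auto simp: pre_digraph.apath_def pre_digraph.awalk_def H_def
        cas_with_proj_eq awalk_verts_with_proj_eq)
  ultimately show ?thesis using that by blast
qed

text \<open>The rooted part grows from \<open>r\<close> by one node at a time. Connectedness gives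
  an arc leaving it, and the new end has a single neighbour inside, which becomes its
  parent.\<close>

lemma rooted_tree_exists:
  assumes T: "undirected_tree T" and r: "r \<in> pverts T"
  shows "\<exists>par rank. rooted_tree T r par rank"
proof -
  interpret pair_graph T using T by (simp add: undirected_tree_def)
  let ?sub = "\<lambda>A. \<lparr>pverts = A, parcs = Restr (parcs T) A\<rparr>"
  have sym: "sym (parcs T)" using arcs_symmetric by (auto simp: sym_def)
  have reach: "(u, v) \<in> (parcs T)\<^sup>*" if "u \<in> pverts T" "v \<in> pverts T" for u v
  proof -
    have "parcs T \<subseteq> pverts T \<times> pverts T" using wellformed' by auto
    then show ?thesis using T that sym by (auto simp: undirected_tree_def connected_with_proj_iff)
  qed
  have "\<exists>A par rank. A \<subseteq> pverts T \<and> card A = Suc n \<and> rooted_tree (?sub A) r par rank"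
    if "n < card (pverts T)" for n
    using that
  proof (induction n)
    case 0
    have "rooted_tree (?sub {r}) r id (\<lambda>_. 0)"
      by unfold_locales (use no_loops' in auto)
    then show ?case using r by (intro exI[of _ "{r}"]) auto
  next
    case (Suc n)
    then obtain A par rank where A: "A \<subseteq> pverts T" "card A = Suc n" "rooted_tree (?sub A) r par rank"
      by auto
    interpret A: rooted_tree "?sub A" r par rank by (rule A)
    have rA: "r \<in> A" using A.root_node by simp
    have "finite A" using A.finite_nodes by simp
    obtain z where "z \<in> pverts T" "z \<notin> A" using A Suc.prems by (metis less_irrefl subsetI subset_antisym)
    then obtain x y where xy: "(x, y) \<in> parcs T" "x \<in> A" "y \<notin> A"
      using rtrancl_leaves[OF reach rA] r by metis
    \<comment> \<open>Two neighbours of \<open>y\<close> in \<open>A\<close> would be joined by a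
      non-empty path inside \<open>A\<close>, and the detour through \<open>y\<close> closes it to a
      cycle with at least three arcs.\<close>
    have uniq: "x' = x" if x': "(x', y) \<in> parcs T" "x' \<in> A" for x'
    proof (rule ccontr)
      assume "x' \<noteq> x"
      have "(x, x') \<in> (Restr (parcs T) A)\<^sup>*"
        using A.connected A.arcs_sym A.arcs_subset xy(2) x'(2) by (simp add: connected_with_proj_iff)
      then obtain p where p: "apath x p x'" "set (pawalk_verts x p) \<subseteq> A"
        using restr_apath[OF A(1) xy(2)] by metis
      have ne: "p \<noteq> []" using p(1) \<open>x' \<noteq> x\<close> by (auto simp: apath_Nil_iff)
      let ?q = "(y, x) # p @ [(x', y)]"
      have w: "awalk x p x'" "distinct (pawalk_verts x p)" using p(1) by (auto simp: apath_def)
      have "awalk x (p @ [(x', y)]) y"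
        using w(1) x'(1) by (rule_tac awalk_appendI) (auto simp: awalk_simps wellformed')
      then have q: "awalk y ?q y" using xy(1) by (auto simp: awalk_Cons_iff arcs_symmetric)
      have "pawalk_verts x (p @ [(x', y)]) = pawalk_verts x p @ [y]"
        using awalk_verts_append[of x p "[(x', y)]" y] \<open>awalk x (p @ [(x', y)]) y\<close> w(1) by simp
      then have "distinct (tl (pawalk_verts y ?q))"
        using w(2) p(2) xy(3) by auto
      then have "cycle ?q" using q by (auto simp: cycle_def)
      moreover have "3 \<le> length ?q" using ne by (cases p) auto
      ultimately show False using T by (auto simp: undirected_tree_def)
    qed
    let ?par = "par(y := x)" and ?rank = "rank(y := Suc (rank x))"
    have "rooted_tree (?sub (insert y A)) r ?par ?rank"
    proof
      show "parcs (?sub (insert y A)) = {(u, v). u \<in> pverts (?sub (insert y A)) - {r} \<and> v = ?par u \<or>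
          v \<in> pverts (?sub (insert y A)) - {r} \<and> u = ?par v}" (is "?L = ?R")
      proof (rule set_eqI, clarify)
        fix u v
        have "(u, v) \<in> parcs T \<longleftrightarrow> u \<in> A - {r} \<and> v = par u \<or> v \<in> A - {r} \<and> u = par v"
          if "u \<in> A" "v \<in> A"
          using A.arcs_eq that by auto
        moreover have "(u, y) \<in> parcs T \<longleftrightarrow> u = x" "(y, u) \<in> parcs T \<longleftrightarrow> u = x" if "u \<in> A" for u
          using uniq[of u] xy that arcs_symmetric[of u y] arcs_symmetric[of y u] by blast+
        moreover have "par u \<in> A" if "u \<in> A" "u \<noteq> r" for u
          using A.par_node that by simp
        moreover have "(y, y) \<notin> parcs T" using no_loops' by blast
        moreover have "y \<noteq> r" using rA xy(3) by auto
        ultimately show "(u, v) \<in> ?L \<longleftrightarrow> (u, v) \<in> ?R"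
          using xy(2,3) by (cases "u = y"; cases "v = y") auto
      qed
    qed (use \<open>finite A\<close> rA xy(2,3) A.par_node A.rank_par in auto)
    moreover have "card (insert y A) = Suc (Suc n)" "insert y A \<subseteq> pverts T"
      using xy A wellformed' \<open>finite A\<close> by auto
    ultimately show ?case by blast
  qed
  from this[of "card (pverts T) - 1"] have "0 < card (pverts T) \<Longrightarrow>
      \<exists>A par rank. A \<subseteq> pverts T \<and> card A = card (pverts T) \<and> rooted_tree (?sub A) r par rank"
    by simp
  moreover have "0 < card (pverts T)" using r pair_finite_verts card_gt_0_iff by blast
  ultimately obtain A par rank where A: "A \<subseteq> pverts T" "card A = card (pverts T)"
      "rooted_tree (?sub A) r par rank"
    by blast
  have "A = pverts T" using card_subset_eq[OF pair_finite_verts A(1,2)] .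
  moreover have "Restr (parcs T) (pverts T) = parcs T" using wellformed' by auto
  then have "?sub (pverts T) = T" by simp
  ultimately show ?thesis using A(3) by auto
qed

section \<open>Balanced separators\<close>

text \<open>
  Among the nodes whose subtree meets \<open>S\<close> in at least half of its vertices, the bag of one of maximal
  rank separates \<open>S\<close>. A vertex outside this bag is labelled by the set of children of the node whose
  subtree contains it, which is empty for vertices outside the subtree of the node.
\<close>

lemma balanced_bag:
  fixes G :: "'a pair_pre_digraph" and T :: "'t pair_pre_digraph"
  assumes td: "tree_decomposition G T B" and S: "S \<subseteq> pverts G" "finite (pverts G)"
  obtains x and lab :: "'a \<Rightarrow> 't set" where "x \<in> pverts T"
    "\<And>v w. (v, w) \<in> parcs G \<Longrightarrow> v \<in> pverts G - B x \<Longrightarrow> w \<in> pverts G - B x \<Longrightarrow> lab v = lab w"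
    "\<And>L. 2 * card {v \<in> S - B x. lab v = L} \<le> card S"
proof -
  have T: "undirected_tree T" using td by (simp add: tree_decomposition_def)
  then obtain r where r: "r \<in> pverts T"
    by (auto simp: undirected_tree_def connected_def strongly_connected_def)
  then obtain par rank where "rooted_tree T r par rank" 
    using rooted_tree_exists[OF T r] by (elim exE)
  then interpret rooted_tree T r par rank .
  \<comment> \<open>\<open>(l, j) \<in> P\<^sup>*\<close> says that \<open>l\<close> lies in the
    subtree of \<open>j\<close>, and \<open>V j\<close> collects the vertices in the bags of this
    subtree.\<close>
  define P where "P = {(x, par x) |x. x \<in> pverts T - {r}}"
  define V where "V j = {v. \<exists>l \<in> pverts T. v \<in> B l \<and> (l, j) \<in> P\<^sup>*}" for j
  have fS: "finite S" using S finite_subset by blast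
  have conn: "connected (with_proj T \<restriction> {x \<in> pverts T. v \<in> B x})" if "v \<in> pverts G" for v
    using td that by (auto simp: tree_decomposition_def)
  have half_root: "card S \<le> 2 * card (S \<inter> V r)"
  proof -
    have to_root: "(x, r) \<in> P\<^sup>*" if "x \<in> pverts T" for x
      using that
    proof (induction "rank x" arbitrary: x rule: less_induct)
      case less
      show ?case
      proof (cases "x = r")
        case False
        then have "(x, par x) \<in> P" "(par x, r) \<in> P\<^sup>*"
          using less rank_par par_node by (auto simp: P_def)
        then show ?thesis by (rule converse_rtrancl_into_rtrancl)
      qed simp
    qed
    have "S \<inter> V r = S"
    proof -
      have "\<exists>l \<in> pverts T. v \<in> B l" if "v \<in> S" for v
        using conn[of v] S that by (auto simp: connected_induce_iff[OF arcs_sym])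
      then show ?thesis using to_root by (fastforce simp: V_def)
    qed
    then show ?thesis by simp
  qed
  define X where "X = {x \<in> pverts T. card S \<le> 2 * card (S \<inter> V x)}"
  have "finite X" "r \<in> X" using finite_nodes root_node half_root by (auto simp: X_def)
  then have "Max (rank ` X) \<in> rank ` X" by (intro Max_in) auto
  then obtain x where x: "x \<in> X" "rank x = Max (rank ` X)" by auto
  have xT: "x \<in> pverts T" using x by (simp add: X_def)
  have child: "2 * card (S \<inter> V j) < card S" if "j \<in> pverts T - {r}" "par j = x" for j
  proof (rule ccontr)
    assume "\<not> ?thesis"
    then have "j \<in> X" using that by (auto simp: X_def)
    then have "rank j \<le> rank x" using x(2) \<open>finite X\<close> by simp
    then show False using rank_par[of j] that by simp
  qed
  define lab where "lab v = {j \<in> pverts T - {r}. par j = x \<and> v \<in> V j}" for v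
  \<comment> \<open>The nodes whose bags contain \<open>v\<close> are connected and avoid
    \<open>x\<close>, so they cannot leave the subtree of the child \<open>j\<close> of
    \<open>x\<close>.\<close>
  have below: "(l', j) \<in> P\<^sup>*"
    if v: "v \<in> pverts G - B x" and l: "l \<in> pverts T" "v \<in> B l" "(l, j) \<in> P\<^sup>*"
      and l': "l' \<in> pverts T" "v \<in> B l'" and j: "par j = x" for v l l' j
  proof -
    have "(l, l') \<in> (Restr (parcs T) {x \<in> pverts T. v \<in> B x})\<^sup>*"
      using conn[of v] v l l' by (auto simp: connected_induce_iff[OF arcs_sym])
    then show ?thesis
    proof induction
      case base then show ?case by (rule l)
    next
      case (step y z)
      have "(y, z) \<in> parcs T" using step.hyps by auto
      then show ?case
      proof (cases rule: arcsE)
        case up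
        have "z \<noteq> x" using step.hyps v by auto
        from step.IH show ?thesis
        proof (cases rule: converse_rtranclE)
          case base
          then show ?thesis using up \<open>z \<noteq> x\<close> j by auto
        next
          case (step y')
          then show ?thesis using up by (auto simp: P_def)
        qed
      next
        case down
        then have "(z, y) \<in> P" by (auto simp: P_def)
        then show ?thesis using step.IH by (rule converse_rtrancl_into_rtrancl)
      qed
    qed
  qed
  \<comment> \<open>The label can be read off any one bag containing \<open>v\<close>; the ends of
    an edge share a bag, hence a label.\<close>
  have lab_eq: "lab v = {j \<in> pverts T - {r}. par j = x \<and> (l, j) \<in> P\<^sup>*}"
    if "v \<in> pverts G - B x" "l \<in> pverts T" "v \<in> B l" for v l
    using below[OF that(1) _ _ _ that(2,3)] that(2,3) by (auto simp: lab_def V_def)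
  show ?thesis
  proof (rule that[of x lab])
    show "x \<in> pverts T" by (rule xT)
    fix v w assume vw: "(v, w) \<in> parcs G" "v \<in> pverts G - B x" "w \<in> pverts G - B x"
    then obtain l where "l \<in> pverts T" "v \<in> B l" "w \<in> B l"
      using td by (auto simp: tree_decomposition_def)
    then show "lab v = lab w" using lab_eq[OF vw(2)] lab_eq[OF vw(3)] by simp
  next
    fix L
    show "2 * card {v \<in> S - B x. lab v = L} \<le> card S"
    \<comment> \<open>The empty label misses the at least half of \<open>S\<close> in the subtree of
      \<open>x\<close>; any other class lies in the subtree of a child, which by maximality holds
      less than half.\<close>
    proof (cases "L = {}")
      case True
      have "v \<notin> V x" if v: "v \<in> S - B x" "lab v = L" for v
      proof
        assume "v \<in> V x"
        then obtain l where l: "l \<in> pverts T" "v \<in> B l" "(l, x) \<in> P\<^sup>*" by (auto simp: V_def)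
        then have "l \<noteq> x" using v by auto
        then obtain j where "(l, j) \<in> P\<^sup>*" "(j, x) \<in> P" using l(3) by (metis rtranclE)
        then have "j \<in> lab v" using l by (auto simp: lab_def V_def P_def)
        then show False using v True by simp
      qed
      then have "{v \<in> S - B x. lab v = L} \<subseteq> S - (S \<inter> V x)" by auto
      then have "card {v \<in> S - B x. lab v = L} \<le> card (S - (S \<inter> V x))"
        using fS by (intro card_mono) auto
      also have "\<dots> = card S - card (S \<inter> V x)" using fS by (intro card_Diff_subset) auto
      finally show ?thesis using x(1) unfolding X_def by simp linarith
    next
      case False
      then obtain j where "j \<in> L" by auto
      show ?thesis
      proof (cases "\<exists>v \<in> S - B x. lab v = L")
        case True
        then have "j \<in> pverts T - {r}" "par j = x" using \<open>j \<in> L\<close> by (auto simp: lab_def)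
        moreover have "{v \<in> S - B x. lab v = L} \<subseteq> S \<inter> V j" using \<open>j \<in> L\<close> by (auto simp: lab_def)
        then have "card {v \<in> S - B x. lab v = L} \<le> card (S \<inter> V j)"
          using fS by (intro card_mono) auto
        ultimately show ?thesis using child[of j] by simp
      next
        case False
        then have "{v \<in> S - B x. lab v = L} = {}" by auto
        then show ?thesis by (simp only: card.empty)
      qed
    qed
  qed
qed

section \<open>Nested tree-decompositions\<close>

datatype 'a rose = Node (bag: "'a set") (kids: "'a rose list")

fun rverts :: "'a rose \<Rightarrow> 'a set" where
  "rverts (Node X ts) = X \<union> (\<Union>t \<in> set ts. rverts t)"

fun bags :: "'a rose \<Rightarrow> 'a set set" where
  "bags (Node X ts) = insert X (\<Union>t \<in> set ts. bags t)"

fun nodes :: "'a rose \<Rightarrow> nat" where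
  "nodes (Node X ts) = Suc (sum_list (map nodes ts))"

text \<open>The condition on the tree edge from a bag \<open>X\<close> to its child
  \<open>t\<close>. The first conjunct is the vertical half of the connected-subtree axiom, the
  second is slickness of the edge.\<close>

definition linked :: "('a \<times> 'a) set \<Rightarrow> 'a set \<Rightarrow> 'a rose \<Rightarrow> bool" where
  "linked E X t \<longleftrightarrow> rverts t \<inter> X \<subseteq> bag t \<and> (\<forall>v \<in> X \<inter> bag t. E `` {v} \<inter> bag t - X \<noteq> {})"

text \<open>Sibling subtrees meet only in the parent bag; together with \<open>linked\<close> this
  contains the connected-subtree axiom. Coverage of edges is kept apart, in
  \<open>covers\<close>.\<close>

fun slick :: "('a \<times> 'a) set \<Rightarrow> 'a rose \<Rightarrow> bool" where
  "slick E (Node X ts) \<longleftrightarrow>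
     sorted_wrt (\<lambda>t u. rverts t \<inter> rverts u \<subseteq> X) ts \<and> (\<forall>t \<in> set ts. linked E X t \<and> slick E t)"

text \<open>Every node except the root brings at least \<open>c\<close> vertices that its parent
  lacks.\<close>

fun heavy :: "nat \<Rightarrow> 'a rose \<Rightarrow> bool" where
  "heavy c (Node X ts) \<longleftrightarrow> (\<forall>t \<in> set ts. c \<le> card (bag t - X) \<and> heavy c t)"

lemma bag_subset_rverts: "bag t \<subseteq> rverts t"
  by (cases t) auto

lemma bags_subset_rverts: "X \<in> bags t \<Longrightarrow> X \<subseteq> rverts t"
  by (induction t) auto

section \<open>Enlarging root bags, absorbing children and gluing\<close>

lemma slick_Node_Cons:
  "slick E (Node X (t # ts)) \<longleftrightarrow>
     linked E X t \<and> slick E t \<and> rverts t \<inter> (\<Union>u \<in> set ts. rverts u) \<subseteq> X \<and> slick E (Node X ts)"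
  by auto

lemma slick_Node_append:
  "slick E (Node X (ts @ us)) \<longleftrightarrow>
     slick E (Node X ts) \<and> slick E (Node X us) \<and>
     (\<Union>t \<in> set ts. rverts t) \<inter> (\<Union>u \<in> set us. rverts u) \<subseteq> X"
  by (auto simp: sorted_wrt_append)

lemma slick_Node_Nil: "slick E (Node X [])"
  by simp

lemmas slick_Node = slick_Node_Cons slick_Node_append slick_Node_Nil

text \<open>The conditions on a child depend on the parent bag only through its intersection with
  the vertices of that child.\<close>

lemma slick_change_bag:
  assumes "slick E (Node X ts)" "(X \<union> Y) \<inter> (\<Union>t \<in> set ts. rverts t) = X \<inter> (\<Union>t \<in> set ts. rverts t)"
  shows "slick E (Node (X \<union> Y) ts)"
  using assms
proof (induction ts)
  case (Cons t ts)
  have "linked E (X \<union> Y) t"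
  proof -
    have "linked E X t" using Cons.prems by (simp add: slick_Node_Cons)
    moreover have "rverts t \<inter> (X \<union> Y) = rverts t \<inter> X" using Cons.prems(2) by auto
    moreover have "bag t \<inter> (X \<union> Y) = bag t \<inter> X"
      using calculation(2) bag_subset_rverts[of t] by blast
    ultimately show ?thesis unfolding linked_def by blast
  qed
  moreover have "slick E (Node (X \<union> Y) ts)"
    using Cons.prems by (intro Cons.IH) (auto simp: slick_Node_Cons)
  ultimately show ?case using Cons.prems(1) unfolding slick_Node_Cons by auto
qed simp

text \<open>Contraction of the edge to \<open>t\<close>. Below \<open>t\<close> the vertices of
  \<open>X\<close> are already in \<open>bag t\<close>, and the siblings meet \<open>t\<close> only
  inside \<open>X\<close>, so the enlarged bag changes no intersection.\<close>

lemma absorb_child: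
  assumes "slick E (Node X (t # ts))"
  shows "slick E (Node (X \<union> bag t) (kids t @ ts))"
proof -
  obtain A as where t: "t = Node A as" by (cases t)
  have *: "linked E X t" "slick E (Node A as)" "rverts t \<inter> (\<Union>u \<in> set ts. rverts u) \<subseteq> X"
    "slick E (Node X ts)"
    using assms unfolding slick_Node_Cons t by auto
  have "slick E (Node (A \<union> X) as)"
    using *(1) by (intro slick_change_bag *) (auto simp: linked_def t)
  moreover have "slick E (Node (X \<union> A) ts)"
    using *(3) by (intro slick_change_bag *) (auto simp: t)
  ultimately show ?thesis
    using *(3) unfolding slick_Node_append by (auto simp: t Un_commute)
qed

definition glue :: "'a rose \<Rightarrow> 'a rose \<Rightarrow> 'a rose" where
  "glue t u = Node (bag t \<union> bag u) (kids t @ kids u)"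

lemma bag_glue: "bag (glue t u) = bag t \<union> bag u"
  by (simp add: glue_def)

lemma rverts_glue: "rverts (glue t u) = rverts t \<union> rverts u"
  by (cases t; cases u) (auto simp: glue_def)

lemma bags_glue_subset: "bags (glue t u) \<subseteq> insert (bag t \<union> bag u) (bags t \<union> bags u)"
  by (cases t; cases u) (auto simp: glue_def)

lemma slick_glue:
  assumes "slick E t" "slick E u" "rverts t \<inter> rverts u \<subseteq> bag t \<inter> bag u"
  shows "slick E (glue t u)"
proof -
  obtain A as where t: "t = Node A as" by (cases t)
  obtain B bs where u: "u = Node B bs" by (cases u)
  have "slick E (Node (A \<union> B) as)"
    using assms by (intro slick_change_bag) (auto simp: t u)
  moreover have "slick E (Node (B \<union> A) bs)"
    using assms by (intro slick_change_bag) (auto simp: t u)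
  ultimately show ?thesis
    using assms(3) unfolding glue_def slick_Node_append by (auto simp: t u Un_commute slick_Node_append)
qed

text \<open>A common vertex lies in \<open>X\<close>, hence by \<open>linked\<close> in both root
  bags. A vertex of \<open>X\<close> in the glued bag keeps the neighbour outside \<open>X\<close>
  that one of the two bags provides.\<close>

lemma glue_siblings:
  assumes "slick E (Node X (t # u # ts))"
  shows "rverts t \<inter> rverts u \<subseteq> bag t \<inter> bag u" "slick E (Node X (glue t u # ts))"
proof -
  have *: "linked E X t" "linked E X u" "slick E t" "slick E u"
    "rverts t \<inter> rverts u \<subseteq> X"
    "(rverts t \<union> rverts u) \<inter> (\<Union>u \<in> set ts. rverts u) \<subseteq> X" "slick E (Node X ts)"
    using assms unfolding slick_Node_Cons by auto
  then show tu: "rverts t \<inter> rverts u \<subseteq> bag t \<inter> bag u"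
    by (auto simp: linked_def)
  have "linked E X (glue t u)"
    using *(1,2) unfolding linked_def rverts_glue bag_glue by blast
  then show "slick E (Node X (glue t u # ts))"
    using * slick_glue[OF _ _ tu] unfolding slick_Node_Cons rverts_glue by auto
qed

text \<open>The form in which edge coverage survives operations that enlarge or merge bags.\<close>

definition refines :: "'a set set \<Rightarrow> 'a set set \<Rightarrow> bool" where
  "refines A B \<longleftrightarrow> (\<forall>X \<in> A. \<exists>Y \<in> B. X \<subseteq> Y)"

lemma refines_refl: "refines A A"
  by (auto simp: refines_def)

lemma refines_trans: "refines A B \<Longrightarrow> refines B C \<Longrightarrow> refines A C"
  unfolding refines_def by (meson subset_trans)

lemma refines_subset: "A \<subseteq> B \<Longrightarrow> refines A B"
  by (auto simp: refines_def)

lemma refines_Un: "refines (A \<union> B) C \<longleftrightarrow> refines A C \<and> refines B C"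
  by (auto simp: refines_def)

lemma refines_bags_glue: "refines (bags t \<union> bags u) (bags (glue t u))"
  by (cases t; cases u) (auto simp: glue_def refines_def)

section \<open>Contracting light children\<close>

text \<open>A vertex of the other root bag that occurs below a root is already in that root's own
  bag, so no child loses new vertices.\<close>

lemma heavy_glue:
  assumes "heavy c t" "heavy c u" "rverts t \<inter> rverts u \<subseteq> bag t \<inter> bag u"
  shows "heavy c (glue t u)"
proof -
  obtain A as where t: "t = Node A as" by (cases t)
  obtain B bs where u: "u = Node B bs" by (cases u)
  have "bag k - (A \<union> B) = bag k - A" if "k \<in> set as" for k
    using assms(3) that bag_subset_rverts[of k] by (auto simp: t u)
  moreover have "bag k - (A \<union> B) = bag k - B" if "k \<in> set bs" for k
    using assms(3) that bag_subset_rverts[of k] by (auto simp: t u)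
  ultimately show ?thesis using assms(1,2) by (auto simp: t u glue_def)
qed

text \<open>All vertices of \<open>X\<close> below \<open>t\<close> are in \<open>bag t\<close>
  already, so the larger bag contains no further ones that would require neighbours.\<close>

lemma linked_replace:
  assumes "linked E X t" "rverts u = rverts t" "bag t \<subseteq> bag u"
  shows "linked E X u"
proof -
  have "X \<inter> bag u = X \<inter> bag t"
    using assms bag_subset_rverts[of u] by (auto simp: linked_def)
  then show ?thesis using assms unfolding linked_def by blast
qed

text \<open>Here \<open>w\<close> bounds the original bags and \<open>c\<close> is the weight below
  which a child is light. The growth \<open>2 * c\<close> comes from merging two light
  children.\<close>

definition contraction :: "('a \<times> 'a) set \<Rightarrow> nat \<Rightarrow> nat \<Rightarrow> 'a rose \<Rightarrow> 'a rose \<Rightarrow> bool" where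
  "contraction E c w t u \<longleftrightarrow> slick E u \<and> rverts u = rverts t \<and> bag t \<subseteq> bag u \<and>
     (\<forall>Y \<in> bags u. card Y \<le> w + 2 * c) \<and> refines (bags t) (bags u) \<and> heavy c u"

text \<open>The child \<open>l\<close> merges the light children met so far, \<open>hs\<close> are heavy, \<open>us\<close> are still to be treated.\<close>

lemma contract_children:
  fixes w c :: nat
  assumes "slick E (Node X (l # hs @ us))" "finite (rverts (Node X (l # hs @ us)))" "card X \<le> w" "0 < c"
    and "\<And>t. t \<in> set us \<Longrightarrow> \<exists>u. contraction E c w t u"
    and "\<And>h. h \<in> set hs \<Longrightarrow> heavy c h \<and> c \<le> card (bag h - X) \<and> (\<forall>Y \<in> bags h. card Y \<le> w + 2 * c)"
    and "heavy c l" "card (bag l - X) < c" "\<And>Y. Y \<in> bags l \<Longrightarrow> card Y \<le> w + 2 * c"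
  shows "\<exists>l' hs'. slick E (Node X (l' # hs')) \<and> rverts (Node X (l' # hs')) = rverts (Node X (l # hs @ us)) \<and>
    refines (bags (Node X (l # hs @ us))) (bags (Node X (l' # hs'))) \<and>
    (\<forall>h \<in> set hs'. heavy c h \<and> c \<le> card (bag h - X) \<and> (\<forall>Y \<in> bags h. card Y \<le> w + 2 * c)) \<and>
    heavy c l' \<and> card (bag l' - X) < c \<and> (\<forall>Y \<in> bags l'. card Y \<le> w + 2 * c)"
    (is "\<exists>l' hs'. ?goal l hs us l' hs'")
  using assms
proof (induction us arbitrary: l hs)
  case Nil
  then show ?case by (intro exI[of _ l] exI[of _ hs]) (auto simp: refines_refl simp del: slick.simps)
next
  case (Cons t us)
  obtain u where u: "slick E u" "rverts u = rverts t" "bag t \<subseteq> bag u"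
     "\<And>Y. Y \<in> bags u \<Longrightarrow> card Y \<le> w + 2 * c" "refines (bags t) (bags u)" "heavy c u"
    using Cons.prems(5)[of t] by (auto simp: contraction_def)
  have "slick E (Node X (t # l # hs @ us))"
    using Cons.prems(1) unfolding slick_Node by auto
  then have slick: "slick E (Node X (u # l # hs @ us))"
    using u linked_replace[of E X t u] unfolding slick_Node_Cons by auto
  have verts: "rverts (Node X (u # l # hs @ us)) = rverts (Node X (l # hs @ t # us))"
    using u(2) by auto
  have ref: "refines (bags (Node X (l # hs @ t # us))) (bags (Node X (u # l # hs @ us)))"
  proof -
    have "refines (bags t) (bags (Node X (u # l # hs @ us)))"
      by (rule refines_trans[OF u(5) refines_subset]) auto
    moreover have "refines (bags (Node X (l # hs @ us))) (bags (Node X (u # l # hs @ us)))"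
      by (rule refines_subset) auto
    ultimately have "refines (bags t \<union> bags (Node X (l # hs @ us))) (bags (Node X (u # l # hs @ us)))"
      by (simp only: refines_Un)
    moreover have "bags (Node X (l # hs @ t # us)) = bags t \<union> bags (Node X (l # hs @ us))"
      by auto
    ultimately show ?thesis by simp
  qed
  have fin: "finite (rverts (Node X (u # l # hs @ us)))"
    using Cons.prems(2) verts by simp
  \<comment> \<open>One round is finished once a new accumulator \<open>l'\<close> and a new list
    \<open>hs'\<close> are exhibited. Below, \<open>u\<close> joins \<open>hs\<close> if heavy;
    otherwise it is merged with \<open>l\<close>, and the result stays the accumulator or, if heavy,
    joins \<open>hs\<close>.\<close>
  have continue: ?case
    if st: "slick E (Node X (l' # hs' @ us))"
      "rverts (Node X (l' # hs' @ us)) = rverts (Node X (u # l # hs @ us))"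
      "refines (bags (Node X (u # l # hs @ us))) (bags (Node X (l' # hs' @ us)))"
      "\<And>h. h \<in> set hs' \<Longrightarrow> heavy c h \<and> c \<le> card (bag h - X) \<and> (\<forall>Y \<in> bags h. card Y \<le> w + 2 * c)"
      "heavy c l'" "card (bag l' - X) < c" "\<And>Y. Y \<in> bags l' \<Longrightarrow> card Y \<le> w + 2 * c" for l' hs'
  proof -
    have "\<exists>l'' hs''. ?goal l' hs' us l'' hs''"
      using st fin Cons.prems(3-5) by (intro Cons.IH) auto
    then show ?thesis
      using refines_trans[OF refines_trans[OF ref st(3)]] st(2) verts by metis
  qed
  show ?case
  proof (cases "c \<le> card (bag u - X)")
    case True
    show ?thesis
    proof (rule continue)
      show "slick E (Node X (l # (u # hs) @ us))"
        using slick unfolding slick_Node by auto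
      show "refines (bags (Node X (u # l # hs @ us))) (bags (Node X (l # (u # hs) @ us)))"
        by (rule refines_subset) auto
    qed (use True u Cons.prems in auto)
  next
    case False
    let ?m = "glue u l"
    note glue = glue_siblings[OF slick]
    have m: "heavy c ?m" using glue(1) u(6) Cons.prems(7) by (intro heavy_glue)
    have finX: "finite X" "finite (bag u)" "finite (bag l)"
      using fin bag_subset_rverts[of u] bag_subset_rverts[of l] by (auto intro: finite_subset)
    have "card (bag ?m - X) \<le> card (bag u - X) + card (bag l - X)"
      unfolding bag_glue Un_Diff by (rule card_Un_le)
    then have new: "card (bag ?m - X) \<le> 2 * c" using False Cons.prems(8) by simp
    \<comment> \<open>The merged bag is measured against the original parent bag, of size at most
      \<open>w\<close>, so earlier growth of \<open>u\<close> and \<open>l\<close> does not add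
      up.\<close>
    have "card (bag ?m) \<le> card (X \<union> (bag ?m - X))"
      using finX by (intro card_mono) (auto simp: bag_glue)
    also have "\<dots> \<le> card X + card (bag ?m - X)" by (rule card_Un_le)
    finally have m_bags: "card Y \<le> w + 2 * c" if "Y \<in> bags ?m" for Y
      using that new Cons.prems(3,9) u(4) bags_glue_subset[of u l] by (auto simp: bag_glue)
    have ref_m: "refines (bags (Node X (u # l # ts))) (bags (Node X (?m # ts)))" for ts
    proof -
      have "refines (bags u \<union> bags l) (bags (Node X (?m # ts)))"
        by (rule refines_trans[OF refines_bags_glue refines_subset]) auto
      moreover have "refines (bags (Node X ts)) (bags (Node X (?m # ts)))"
        by (rule refines_subset) auto
      moreover have "bags (Node X (u # l # ts)) = (bags u \<union> bags l) \<union> bags (Node X ts)" by auto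
      ultimately show ?thesis by (simp only: refines_Un)
    qed
    show ?thesis
    proof (cases "card (bag ?m - X) < c")
      case True
      show ?thesis
      proof (rule continue[of ?m hs])
        show "slick E (Node X (?m # hs @ us))" by (rule glue(2))
        show "refines (bags (Node X (u # l # hs @ us))) (bags (Node X (?m # hs @ us)))" by (rule ref_m)
      qed (use True m m_bags Cons.prems rverts_glue[of u l] in auto)
    next
      case False
      \<comment> \<open>The empty node restarts the accumulator.\<close>
      let ?e = "Node {} []"
      show ?thesis
      proof (rule continue[of ?e "?m # hs"])
        show "slick E (Node X (?e # (?m # hs) @ us))"
          using glue(2) by (simp add: linked_def)
        have "refines (bags (Node X (?m # hs @ us))) (bags (Node X (?e # (?m # hs) @ us)))"
          by (rule refines_subset) auto
        then show "refines (bags (Node X (u # l # hs @ us))) (bags (Node X (?e # (?m # hs) @ us)))"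
          by (rule refines_trans[OF ref_m])
      qed (use False m m_bags Cons.prems rverts_glue[of u l] in auto)
    qed
  qed
qed

text \<open>The children are contracted first and then grouped, and the leftover light child is
  absorbed into the root, which grows by less than \<open>c\<close>.\<close>

lemma contraction_exists:
  fixes w c :: nat
  assumes "slick E t" "finite (rverts t)" "\<And>X. X \<in> bags t \<Longrightarrow> card X \<le> w" "0 < c"
  shows "\<exists>u. contraction E c w t u"
  using assms
proof (induction t)
  case (Node X ts)
  let ?e = "Node {} []"
  have kids: "\<exists>u. contraction E c w t u" if "t \<in> set ts" for t
    using that Node.prems by (intro Node.IH) (auto intro: finite_subset)
  have "slick E (Node X (?e # [] @ ts))"
    using Node.prems(1) by (simp add: linked_def)
  moreover have "finite (rverts (Node X (?e # [] @ ts)))" using Node.prems(2) by simp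
  moreover have "card X \<le> w" using Node.prems(3) by simp
  ultimately obtain l hs where lhs: "slick E (Node X (l # hs))"
    "rverts (Node X (l # hs)) = rverts (Node X (?e # [] @ ts))"
    "refines (bags (Node X (?e # [] @ ts))) (bags (Node X (l # hs)))"
    "\<forall>h \<in> set hs. heavy c h \<and> c \<le> card (bag h - X) \<and> (\<forall>Y \<in> bags h. card Y \<le> w + 2 * c)"
    "heavy c l" "card (bag l - X) < c" "\<forall>Y \<in> bags l. card Y \<le> w + 2 * c"
    using contract_children[of E X ?e "[]" ts w c] kids Node.prems(4) by auto
  obtain A as where l: "l = Node A as" by (cases l)
  have link: "linked E X l" "rverts l \<inter> (\<Union>h \<in> set hs. rverts h) \<subseteq> X"
    using lhs(1) unfolding slick_Node_Cons by auto
  let ?u = "Node (X \<union> A) (as @ hs)"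
  have "slick E ?u" using absorb_child[OF lhs(1)] by (simp only: l rose.sel)
  moreover have "rverts ?u = rverts (Node X ts)" using lhs(2) by (auto simp: l)
  moreover have "card Y \<le> w + 2 * c" if "Y \<in> bags ?u" for Y
  proof -
    have "finite (rverts (Node X (l # hs)))" using lhs(2) Node.prems(2) by simp
    then have "finite X" "finite A" by (auto simp: l)
    then have "card (X \<union> A) \<le> card X + card (A - X)"
      by (metis Un_Diff_cancel card_Un_le)
    then have "card (X \<union> A) \<le> w + 2 * c"
      using \<open>card X \<le> w\<close> lhs(6) by (simp add: l)
    then show ?thesis using that lhs(4,7) by (auto simp: l)
  qed
  moreover have "refines (bags (Node X ts)) (bags ?u)"
  proof (rule refines_trans)
    show "refines (bags (Node X ts)) (bags (Node X (l # hs)))"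
      by (rule refines_trans[OF refines_subset lhs(3)]) auto
    show "refines (bags (Node X (l # hs))) (bags ?u)"
      by (auto simp: l refines_def)
  qed
  moreover have "heavy c ?u"
  proof -
    \<comment> \<open>Absorbing \<open>l\<close> takes no new vertices from its children, as
      \<open>A\<close> already holds their vertices of \<open>X\<close>, nor from its siblings,
      which meet \<open>A\<close> only in \<open>X\<close>.\<close>
    have "bag k - (X \<union> A) = bag k - A" if "k \<in> set as" for k
      using link(1) that bag_subset_rverts[of k] by (auto simp: l linked_def)
    moreover have "bag h - (X \<union> A) = bag h - X" if "h \<in> set hs" for h
      using link(2) that bag_subset_rverts[of h] by (auto simp: l)
    ultimately show ?thesis using lhs(4,5) by (auto simp: l)
  qed
  ultimately have "contraction E c w (Node X ts) ?u" by (auto simp: contraction_def)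
  then show ?case ..
qed

text \<open>Outside \<open>X\<close> the children's vertex sets are disjoint, and each has at least
  \<open>c\<close> vertices per node: \<open>c\<close> from its own root bag and the rest by
  induction.\<close>

lemma heavy_nodes:
  assumes "slick E t" "heavy c t" "finite (rverts t)"
  shows "c * (nodes t - 1) + card (bag t) \<le> card (rverts t)"
  using assms
proof (induction t)
  case (Node X ts)
  have kid: "c * nodes t \<le> card (rverts t - X)" if "t \<in> set ts" for t
  proof -
    have t: "slick E t" "heavy c t" "finite (rverts t)" "linked E X t" "c \<le> card (bag t - X)"
      using Node.prems that by (auto intro: finite_subset)
    have fb: "finite (bag t)" by (rule finite_subset[OF bag_subset_rverts t(3)])
    \<comment> \<open>Hence removing \<open>X\<close> costs \<open>rverts t\<close> exactly as many
      vertices as \<open>bag t\<close>.\<close>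
    have eq: "rverts t \<inter> X = bag t \<inter> X" using t(4) bag_subset_rverts[of t] by (auto simp: linked_def)
    have "card (rverts t - X) + card (bag t \<inter> X) = card (rverts t)"
      using card_Int_Diff[OF t(3), of X] eq by simp
    moreover have "card (bag t - X) + card (bag t \<inter> X) = card (bag t)"
      using card_Int_Diff[OF fb, of X] by simp
    moreover have "c * (nodes t - 1) + card (bag t) \<le> card (rverts t)"
      using Node.IH that t by blast
    moreover have "c * nodes t = c * (nodes t - 1) + c"
      by (cases t) simp
    ultimately show ?thesis using t(5) by linarith
  qed
  have "(\<Sum>t\<leftarrow>ts. c * nodes t) \<le> card ((\<Union>t \<in> set ts. rverts t) - X)"
    using kid Node.prems(1,3)
  proof (induction ts)
    case (Cons t ts)
    let ?A = "rverts t - X" and ?B = "(\<Union>t \<in> set ts. rverts t) - X"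
    have "?A \<inter> ?B = {}" using Cons.prems(2) unfolding slick_Node_Cons by auto
    moreover have "finite ?A" "finite ?B" using Cons.prems(3) by auto
    moreover have "(\<Union>t \<in> set (t # ts). rverts t) - X = ?A \<union> ?B" by auto
    ultimately have "card ((\<Union>t \<in> set (t # ts). rverts t) - X) = card ?A + card ?B"
      by (simp only: card_Un_disjoint)
    moreover have "(\<Sum>t\<leftarrow>ts. c * nodes t) \<le> card ?B"
      using Cons.prems unfolding slick_Node_Cons by (intro Cons.IH) auto
    ultimately show ?case using Cons.prems(1)[of t] by simp
  qed simp
  moreover have "card (rverts (Node X ts)) = card X + card ((\<Union>t \<in> set ts. rverts t) - X)"
  proof -
    have "rverts (Node X ts) = X \<union> ((\<Union>t \<in> set ts. rverts t) - X)" by auto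
    moreover have "finite X" "finite ((\<Union>t \<in> set ts. rverts t) - X)" using Node.prems(3) by auto
    ultimately show ?thesis by (metis Diff_disjoint card_Un_disjoint)
  qed
  ultimately show ?case by (simp add: sum_list_const_mult)
qed

section \<open>Splitting along a separator\<close>

text \<open>If one class has a third of \<open>W\<close>, it is one side. Otherwise a smallest set
  of labels reaching a third stays below two thirds, because dropping a label falls below a third
  and that label has less than a third.\<close>

lemma group_labels:
  fixes lab :: "'a \<Rightarrow> 'l"
  assumes fin: "finite W" and small: "\<And>L. 3 * card {v \<in> W. lab v = L} \<le> 2 * card W"
  obtains I where "card W \<le> 3 * card {v \<in> W. lab v \<in> I}" "card W \<le> 3 * card {v \<in> W. lab v \<notin> I}"
proof -
  have compl: "card {v \<in> W. lab v \<in> I} + card {v \<in> W. lab v \<notin> I} = card W" for I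
  proof -
    have "card ({v \<in> W. lab v \<in> I} \<union> {v \<in> W. lab v \<notin> I}) = card {v \<in> W. lab v \<in> I} + card {v \<in> W. lab v \<notin> I}"
      using fin by (intro card_Un_disjoint) auto
    moreover have "{v \<in> W. lab v \<in> I} \<union> {v \<in> W. lab v \<notin> I} = W" by auto
    ultimately show ?thesis by simp
  qed
  show ?thesis
  proof (cases "\<exists>L. card W \<le> 3 * card {v \<in> W. lab v = L}")
    case True
    then obtain L where L: "card W \<le> 3 * card {v \<in> W. lab v = L}" by auto
    show ?thesis
      using that[of "{L}"] L small[of L] compl[of "{L}"] by auto
  next
    case False
    let ?P = "\<lambda>I. I \<subseteq> lab ` W \<and> card W \<le> 3 * card {v \<in> W. lab v \<in> I}"
    have "{v \<in> W. lab v \<in> lab ` W} = W" by auto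
    then have "?P (lab ` W)" by simp
    then have "\<exists>I. ?P I \<and> (\<forall>J. ?P J \<longrightarrow> card I \<le> card J)"
      by (rule ex_has_least_nat)
    then obtain I where "?P I \<and> (\<forall>J. ?P J \<longrightarrow> card I \<le> card J)" ..
    then have I: "?P I" "\<And>J. ?P J \<Longrightarrow> card I \<le> card J" by simp_all
    have "card W \<le> 3 * card {v \<in> W. lab v \<notin> I}"
    proof (cases "I = {}")
      case False
      then obtain i where i: "i \<in> I" by auto
      have "finite I" using I(1) fin by (auto intro: finite_subset)
      then have "card (I - {i}) < card I" using i by (intro card_Diff1_less)
      then have "\<not> ?P (I - {i})" using I(2)[of "I - {i}"] by (simp only: not_le[symmetric]) blast
      then have small: "3 * card {v \<in> W. lab v \<in> I - {i}} < card W" using I(1) by auto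
      have split: "{v \<in> W. lab v \<in> I} = {v \<in> W. lab v \<in> I - {i}} \<union> {v \<in> W. lab v = i}" using i by auto
      have "card {v \<in> W. lab v \<in> I} \<le> card {v \<in> W. lab v \<in> I - {i}} + card {v \<in> W. lab v = i}"
        unfolding split by (rule card_Un_le)
      moreover have "3 * card {v \<in> W. lab v = i} < card W"
        using \<open>\<not> (\<exists>L. card W \<le> 3 * card {v \<in> W. lab v = L})\<close> by (meson not_le)
      ultimately show ?thesis using small compl[of I] by linarith
    qed simp
    then show ?thesis using that I(1) by blast
  qed
qed

text \<open>Label classes are unions of components of \<open>V - X\<close>. The last argument fixes
  the type of labels, which is bound inside the body.\<close>

definition balanced_separable :: "('a \<times> 'a) set \<Rightarrow> 'a set \<Rightarrow> nat \<Rightarrow> 'l itself \<Rightarrow> bool" where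
  "balanced_separable E V K _ \<longleftrightarrow> (\<forall>S \<subseteq> V. \<exists>X (lab :: 'a \<Rightarrow> 'l). finite X \<and> card X \<le> K \<and>
     (\<forall>v \<in> V - X. \<forall>w \<in> V - X. (v, w) \<in> E \<longrightarrow> lab v = lab w) \<and>
     (\<forall>L. 2 * card {v \<in> S - X. lab v = L} \<le> card S))"

lemma balanced_split:
  assumes sep: "balanced_separable E V K TYPE('l)"
    and S: "S \<subseteq> U" "U \<subseteq> V" "finite V" "4 * K \<le> card S"
  obtains U1 U2 where "U1 \<union> U2 = U" "card (U1 \<inter> U2) = K"
    "\<And>v w. v \<in> U \<Longrightarrow> w \<in> U \<Longrightarrow> (v, w) \<in> E \<Longrightarrow> v \<in> U1 \<and> w \<in> U1 \<or> v \<in> U2 \<and> w \<in> U2"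
    "card (S - U1 \<inter> U2) \<le> 3 * card (S \<inter> U1 - U2)" "card (S - U1 \<inter> U2) \<le> 3 * card (S \<inter> U2 - U1)"
proof -
  obtain X0 and lab :: "'a \<Rightarrow> 'l" where X0: "finite X0" "card X0 \<le> K"
    "\<And>v w. v \<in> V - X0 \<Longrightarrow> w \<in> V - X0 \<Longrightarrow> (v, w) \<in> E \<Longrightarrow> lab v = lab w"
    "\<And>L. 2 * card {v \<in> S - X0. lab v = L} \<le> card S"
    using sep S unfolding balanced_separable_def by (meson subset_trans)
  have fin: "finite S" "finite U" using S by (auto intro: finite_subset)
  have "card (X0 \<inter> U) \<le> K"
    using X0(1,2) card_mono[of X0 "X0 \<inter> U"] by simp
  moreover have "K \<le> card (X0 \<inter> U \<union> S)"
    using S(4) fin card_mono[of "X0 \<inter> U \<union> S" S] by simp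
  \<comment> \<open>Vertices of \<open>S\<close> pad the separator to size exactly \<open>K\<close>,
    which the count after gluing uses.\<close>
  ultimately obtain X where X: "X0 \<inter> U \<subseteq> X" "X \<subseteq> X0 \<inter> U \<union> S" "card X = K"
    using exists_subset_between[of "X0 \<inter> U" K "X0 \<inter> U \<union> S"] fin by auto
  have XU: "X \<subseteq> U" using X S by auto
  have fX: "finite X" using XU fin finite_subset by blast
  let ?W = "S - X"
  have W: "card S \<le> card ?W + K"
    using card_Un_le[of ?W X] card_mono[of "?W \<union> X" S] fX fin X(3) by fastforce
  \<comment> \<open>Since \<open>|?W| \<ge> |S| - K \<ge> 3/4 |S|\<close>, half of \<open>S\<close>
    is at most two thirds of \<open>?W\<close>.\<close>
  have "3 * card {v \<in> ?W. lab v = L} \<le> 2 * card ?W" for L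
  proof -
    have "{v \<in> ?W. lab v = L} \<subseteq> {v \<in> S - X0. lab v = L}" using X(1) S by auto
    then have "card {v \<in> ?W. lab v = L} \<le> card {v \<in> S - X0. lab v = L}"
      using fin by (intro card_mono) auto
    then show ?thesis using X0(4)[of L] W S(4) by linarith
  qed
  then obtain I where I: "card ?W \<le> 3 * card {v \<in> ?W. lab v \<in> I}" "card ?W \<le> 3 * card {v \<in> ?W. lab v \<notin> I}"
    using group_labels[of ?W lab] fin by auto
  let ?U1 = "X \<union> {v \<in> U. lab v \<in> I}" and ?U2 = "X \<union> {v \<in> U. lab v \<notin> I}"
  have int: "?U1 \<inter> ?U2 = X" by auto
  show ?thesis
  proof (rule that[of ?U1 ?U2])
    show "?U1 \<union> ?U2 = U" using XU by auto
    show "card (?U1 \<inter> ?U2) = K" using int X by simp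
    fix v w assume vw: "v \<in> U" "w \<in> U" "(v, w) \<in> E"
    then have "v \<in> V" "w \<in> V" using S(2) by auto
    with vw show "v \<in> ?U1 \<and> w \<in> ?U1 \<or> v \<in> ?U2 \<and> w \<in> ?U2"
      using X0(3)[of v w] X(1) S(2) by (cases "v \<in> X0"; cases "w \<in> X0") auto
  next
    have "S \<inter> ?U1 - ?U2 = {v \<in> ?W. lab v \<in> I}" "S \<inter> ?U2 - ?U1 = {v \<in> ?W. lab v \<notin> I}" using S by auto
    then show "card (S - ?U1 \<inter> ?U2) \<le> 3 * card (S \<inter> ?U1 - ?U2)"
      "card (S - ?U1 \<inter> ?U2) \<le> 3 * card (S \<inter> ?U2 - ?U1)"
      using I int by simp_all
  qed
qed

section \<open>Slick decompositions with small bags\<close>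

text \<open>Only edges inside \<open>rverts t\<close> count, so the same \<open>E\<close> serves for
  all induced subgraphs in the recursion.\<close>

definition covers :: "('a \<times> 'a) set \<Rightarrow> 'a rose \<Rightarrow> bool" where
  "covers E t \<longleftrightarrow> (\<forall>(v, w) \<in> E. v \<in> rverts t \<longrightarrow> w \<in> rverts t \<longrightarrow> (\<exists>X \<in> bags t. v \<in> X \<and> w \<in> X))"

lemma refines_covers:
  assumes "\<exists>X \<in> A. v \<in> X \<and> w \<in> X" "refines A B"
  shows "\<exists>Y \<in> B. v \<in> Y \<and> w \<in> Y"
  using assms unfolding refines_def by (meson subsetD)

lemma coversD:
  "covers E t \<Longrightarrow> (v, w) \<in> E \<Longrightarrow> v \<in> rverts t \<Longrightarrow> w \<in> rverts t \<Longrightarrow> \<exists>X \<in> bags t. v \<in> X \<and> w \<in> X"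
  by (auto simp: covers_def)

text \<open>
  The bound \<open>2 |S| - 3 K\<close> on the root bag is the one preserved by gluing along a separator of
  size \<open>K\<close>: the two sides have \<open>|S| + 2 K\<close> vertices to start with at most, and the separator is counted twice
  in the union, so the new root has at most \<open>2 (|S| + 2 K) - 6 K - K\<close> vertices.
\<close>

definition good :: "('a \<times> 'a) set \<Rightarrow> nat \<Rightarrow> 'a set \<Rightarrow> 'a set \<Rightarrow> 'a rose \<Rightarrow> bool" where
  "good E K U S t \<longleftrightarrow> slick E t \<and> rverts t = U \<and> S \<subseteq> bag t \<and> card (bag t) + 3 * K \<le> 2 * card S \<and>
     (\<forall>X \<in> bags t. card X \<le> 25 * K) \<and> covers E t"

text \<open>The measure has two summands because the step for small \<open>S\<close> may keep all of
  \<open>U\<close> while enlarging \<open>S\<close>; splitting makes \<open>U\<close> itself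
  smaller.\<close>

lemma good_exists:
  assumes sep: "balanced_separable E V K TYPE('l)" and E: "sym E" and V: "finite V" and K: "0 < K"
    and "S \<subseteq> U" "U \<subseteq> V" "3 * K \<le> card S" "card S \<le> 14 * K"
  shows "\<exists>t. good E K U S t"
  using assms(5-)
proof (induction "card U + card (U - S)" arbitrary: S U rule: less_induct)
  case less
  have fin: "finite U" "finite S" using less.prems V by (auto intro: finite_subset)
  show ?case
  proof (cases "card S \<le> 7 * K")
    case True
    define N where "N = {v \<in> S. E `` {v} \<inter> (U - S) \<noteq> {}}"
    define U' where "U' = U - (S - N)"
    have N: "N \<subseteq> S" "finite N" using fin by (auto simp: N_def)
    have SU': "S \<inter> U' = N" using N less.prems by (auto simp: U'_def)
    have fU': "finite U'" "U' \<subseteq> U" using fin by (auto simp: U'_def)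
    have edges: "v \<in> S \<and> w \<in> S \<or> v \<in> U' \<and> w \<in> U'" if "v \<in> U" "w \<in> U" "(v, w) \<in> E" for v w
      using that symD[OF E that(3)] by (auto simp: U'_def N_def)
    \<comment> \<open>Hangs \<open>t\<close> below the root bag \<open>S\<close>. The edge is slick
      because \<open>S\<close> meets \<open>U'\<close> only in \<open>N\<close>; the root bound
      \<open>|S| + 3 K \<le> 2 |S|\<close> is the assumption \<open>3 K \<le> |S|\<close>.\<close>
    have finish: "\<exists>t. good E K U S t"
      if t: "slick E t" "rverts t = U'" "N \<subseteq> bag t" "\<And>v. v \<in> N \<Longrightarrow> E `` {v} \<inter> bag t - S \<noteq> {}"
        "\<And>X. X \<in> bags t \<Longrightarrow> card X \<le> 25 * K" "covers E t" for t
    proof -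
      have "S \<inter> bag t \<subseteq> N" using SU' t(2) bag_subset_rverts[of t] by auto
      then have "linked E S t" using t(2-4) SU' unfolding linked_def by blast
      then have "slick E (Node S [t])" using t(1) by simp
      moreover have "rverts (Node S [t]) = U" using t(2) less.prems(1) by (auto simp: U'_def)
      moreover have "covers E (Node S [t])"
        unfolding covers_def \<open>rverts (Node S [t]) = U\<close>
      proof clarify
        fix v w assume vw: "(v, w) \<in> E" "v \<in> U" "w \<in> U"
        show "\<exists>X \<in> bags (Node S [t]). v \<in> X \<and> w \<in> X"
          using edges[OF vw(2,3,1)] t(6) vw(1) t(2) by (auto simp: covers_def)
      qed
      ultimately have "good E K U S (Node S [t])"
        using t(5) True less.prems(3) by (auto simp: good_def)
      then show ?thesis ..
    qed
    show ?thesis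
    proof (cases "card U' \<le> 14 * K")
      case True
      show ?thesis
        by (rule finish[of "Node U' []"])
          (use True SU' in \<open>auto simp: covers_def N_def U'_def\<close>)
    next
      case False
      have "\<forall>v \<in> N. \<exists>w. w \<in> U - S \<and> (v, w) \<in> E" by (auto simp: N_def)
      then obtain f where f: "\<And>v. v \<in> N \<Longrightarrow> f v \<in> U - S \<and> (v, f v) \<in> E" by metis
      have "card (N \<union> f ` N) \<le> card N + card N"
        using card_Un_le[of N "f ` N"] card_image_le[OF N(2), of f] by linarith
      moreover have "card N \<le> card S" using N fin by (intro card_mono)
      ultimately have "card (N \<union> f ` N) \<le> 14 * K" using \<open>card S \<le> 7 * K\<close> by linarith
      moreover have "N \<union> f ` N \<subseteq> U'" using f SU' by (auto simp: U'_def)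
      \<comment> \<open>Padding to \<open>14 * K\<close>, more than \<open>|S|\<close>, puts a
        vertex outside \<open>S\<close> into \<open>S'\<close>, so the measure drops even if
        \<open>N\<close> is empty.\<close>
      ultimately obtain S' where S': "N \<union> f ` N \<subseteq> S'" "S' \<subseteq> U'" "card S' = 14 * K"
        using exists_subset_between[of "N \<union> f ` N" "14 * K" U'] False fU' by auto
      have "card U' + card (U' - S') < card U + card (U - S)"
      proof -
        have "\<not> S' \<subseteq> S" using S'(3) \<open>card S \<le> 7 * K\<close> K card_mono[OF fin(2), of S'] by auto
        then have "U' - S' \<subset> U - S" using S' SU' fU' by (auto simp: U'_def)
        then have "card (U' - S') < card (U - S)" using fin by (intro psubset_card_mono) auto
        moreover have "card U' \<le> card U" using fU' fin by (intro card_mono)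
        ultimately show ?thesis by linarith
      qed
      then obtain t where t: "good E K U' S' t"
        using less.hyps[of U' S'] S' fU' less.prems(2) by auto
      show ?thesis
      proof (rule finish[of t])
        fix v assume "v \<in> N"
        then have "f v \<in> E `` {v} \<inter> bag t - S"
          using f[of v] S'(1) t by (auto simp: good_def)
        then show "E `` {v} \<inter> bag t - S \<noteq> {}" by blast
      qed (use t S'(1) in \<open>auto simp: good_def\<close>)
    qed
  next
    case False
    then obtain U1 U2 where U12: "U1 \<union> U2 = U" "card (U1 \<inter> U2) = K"
      "\<And>v w. v \<in> U \<Longrightarrow> w \<in> U \<Longrightarrow> (v, w) \<in> E \<Longrightarrow> v \<in> U1 \<and> w \<in> U1 \<or> v \<in> U2 \<and> w \<in> U2"
      "card (S - U1 \<inter> U2) \<le> 3 * card (S \<inter> U1 - U2)" "card (S - U1 \<inter> U2) \<le> 3 * card (S \<inter> U2 - U1)"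
      using balanced_split[OF sep less.prems(1,2) V] by auto
    let ?X = "U1 \<inter> U2"
    let ?S1 = "(S \<inter> U1 - U2) \<union> ?X" and ?S2 = "(S \<inter> U2 - U1) \<union> ?X"
    have fX: "finite ?X" using fin U12(1) by auto
    have fU: "finite U1" "finite U2" using fin U12(1) by auto
    have W: "card S \<le> card (S - ?X) + K" "card (S - ?X) \<le> card S"
      using card_Un_le[of "S - ?X" ?X] card_mono[of "(S - ?X) \<union> ?X" S] fX fin U12(2)
      by (fastforce, intro card_mono) auto
    have "S - ?X = (S \<inter> U1 - U2) \<union> (S \<inter> U2 - U1)" using U12(1) less.prems(1) by auto
    then have sum: "card (S - ?X) = card (S \<inter> U1 - U2) + card (S \<inter> U2 - U1)"
      using fin by (simp only:) (intro card_Un_disjoint, auto)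
    have S1: "card ?S1 = card (S \<inter> U1 - U2) + K"
      using fin fX U12(2) by (subst card_Un_disjoint) auto
    have S2: "card ?S2 = card (S \<inter> U2 - U1) + K"
      using fin fX U12(2) by (subst card_Un_disjoint) auto
    \<comment> \<open>From \<open>|S| > 7 K\<close> at least a third of more than \<open>6 K\<close>
      vertices lies on each side. With the separator this exceeds \<open>3 K\<close>, and the
      opposite side's share keeps it below \<open>|S|\<close>.\<close>
    have size: "2 * K < card (S \<inter> U1 - U2)" "2 * K < card (S \<inter> U2 - U1)"
      using U12(4,5) W False by linarith+
    have "\<exists>t1. good E K U1 ?S1 t1"
    proof (rule less.hyps)
      have "S \<inter> U2 - U1 \<noteq> {}" using size(2) by (metis card.empty not_less0)
      then have "card U1 < card U" using U12(1) fin by (intro psubset_card_mono) auto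
      moreover have "card (U1 - ?S1) \<le> card (U - S)" using U12(1) fin by (intro card_mono) auto
      ultimately show "card U1 + card (U1 - ?S1) < card U + card (U - S)" by linarith
    qed (use S1 size sum W U12(1) less.prems in auto)
    then obtain t1 where t1: "good E K U1 ?S1 t1" ..
    have "\<exists>t2. good E K U2 ?S2 t2"
    proof (rule less.hyps)
      have "S \<inter> U1 - U2 \<noteq> {}" using size(1) by (metis card.empty not_less0)
      then have "card U2 < card U" using U12(1) fin by (intro psubset_card_mono) auto
      moreover have "card (U2 - ?S2) \<le> card (U - S)" using U12(1) fin by (intro card_mono) auto
      ultimately show "card U2 + card (U2 - ?S2) < card U + card (U - S)" by linarith
    qed (use S2 size sum W U12(1) less.prems in auto)
    then obtain t2 where t2: "good E K U2 ?S2 t2" ..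
    let ?t = "glue t1 t2"
    have root: "card (bag ?t) + 3 * K \<le> 2 * card S"
    proof -
      have f: "finite (bag t1)" "finite (bag t2)"
        using t1 t2 fU bag_subset_rverts[of t1] bag_subset_rverts[of t2]
        by (auto simp: good_def intro: finite_subset)
      have "?X \<subseteq> bag t1 \<inter> bag t2" using t1 t2 by (auto simp: good_def)
      then have "K \<le> card (bag t1 \<inter> bag t2)"
        using card_mono[of "bag t1 \<inter> bag t2" ?X] f U12(2) by simp
      moreover have "card (bag t1) + card (bag t2) = card (bag ?t) + card (bag t1 \<inter> bag t2)"
        unfolding bag_glue using f by (rule card_Un_Int)
      moreover have "card (bag t1) + 3 * K \<le> 2 * card ?S1" "card (bag t2) + 3 * K \<le> 2 * card ?S2"
        using t1 t2 by (auto simp: good_def)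
      ultimately show ?thesis using S1 S2 sum W by linarith
    qed
    have "slick E ?t"
      using t1 t2 by (intro slick_glue) (auto simp: good_def)
    moreover have verts: "rverts ?t = U"
      using t1 t2 U12(1) unfolding rverts_glue by (simp add: good_def)
    moreover have "S \<subseteq> bag ?t"
      using t1 t2 U12(1) less.prems(1) unfolding bag_glue good_def by blast
    \<comment> \<open>The new root has at most \<open>2 * 14 K - 3 K = 25 K\<close>
      vertices.\<close>
    moreover have "card X \<le> 25 * K" if "X \<in> bags ?t" for X
      using that bags_glue_subset[of t1 t2] t1 t2 root less.prems(4)
      by (auto simp: good_def bag_glue)
    moreover have "covers E ?t"
      unfolding covers_def verts
    proof clarify
      fix v w assume vw: "(v, w) \<in> E" "v \<in> U" "w \<in> U"
      have "\<exists>X \<in> bags t1 \<union> bags t2. v \<in> X \<and> w \<in> X"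
        using U12(3)[OF vw(2,3,1)] t1 t2 coversD[OF _ vw(1), of t1] coversD[OF _ vw(1), of t2]
        unfolding good_def by blast
      then show "\<exists>X \<in> bags ?t. v \<in> X \<and> w \<in> X"
        by (rule refines_covers[OF _ refines_bags_glue])
    qed
    ultimately have "good E K U S ?t" using root by (auto simp: good_def)
    then show ?thesis ..
  qed
qed

lemma small_order_exists:
  assumes sep: "balanced_separable E V K TYPE('l)" and E: "sym E" and V: "finite V" and K: "0 < K"
    and "14 * K \<le> card V"
  shows "\<exists>t. slick E t \<and> rverts t = V \<and> covers E t \<and> (\<forall>X \<in> bags t. card X \<le> 53 * K) \<and> 14 * K * nodes t \<le> card V"
proof -
  obtain S where S: "S \<subseteq> V" "card S = 14 * K"
    using exists_subset_between[of "{}" "14 * K" V] assms(5) V by auto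
  obtain t where t: "good E K V S t"
    using good_exists[OF sep E V K S(1)] S K by auto
  obtain u where u: "contraction E (14 * K) (25 * K) t u"
    using contraction_exists[of E t "25 * K" "14 * K"] t V K by (auto simp: good_def)
  have verts: "rverts u = V" using u t by (simp add: contraction_def good_def)
  \<comment> \<open>The root thus pays for itself, turning \<open>nodes u - 1\<close> in
    \<open>heavy_nodes\<close> into \<open>nodes u\<close>.\<close>
  have "S \<subseteq> bag u" using u t by (auto simp: contraction_def good_def)
  then have "14 * K \<le> card (bag u)"
    using S(2) card_mono[of "bag u" S] V verts bag_subset_rverts[of u] by (metis finite_subset)
  moreover have "14 * K * (nodes u - 1) + card (bag u) \<le> card V"
    using heavy_nodes[of E u "14 * K"] u V verts by (auto simp: contraction_def)
  moreover have "14 * K * nodes u = 14 * K * (nodes u - 1) + 14 * K"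
    by (cases u) simp
  ultimately have "14 * K * nodes u \<le> card V" by linarith
  moreover have "covers E u"
    unfolding covers_def verts
  proof clarify
    fix v w assume "(v, w) \<in> E" "v \<in> V" "w \<in> V"
    then have "\<exists>X \<in> bags t. v \<in> X \<and> w \<in> X"
      using t by (intro coversD) (simp_all add: good_def)
    then show "\<exists>X \<in> bags u. v \<in> X \<and> w \<in> X"
      by (rule refines_covers) (use u in \<open>simp add: contraction_def\<close>)
  qed
  moreover have "slick E u" using u by (simp add: contraction_def)
  moreover have "\<forall>X \<in> bags u. card X \<le> 53 * K" using u by (simp add: contraction_def)
  ultimately show ?thesis using verts by blast
qed

section \<open>From nested decompositions to trees on natural numbers\<close>

text \<open>A node is addressed by the child indices on the way down from the root, so
  \<open>butlast\<close> gives the address of the parent.\<close>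

primrec pos :: "'a rose \<Rightarrow> nat list set" where
  "pos (Node X ts) = insert [] {i # p |i p. i < length ts \<and> p \<in> map pos ts ! i}"

declare pos.simps[simp del]

lemma pos_Node: "pos (Node X ts) = insert [] (\<Union>i<length ts. (#) i ` pos (ts ! i))"
  by (auto simp: pos.simps)

fun bag_at :: "'a rose \<Rightarrow> nat list \<Rightarrow> 'a set" where
  "bag_at t [] = bag t"
| "bag_at t (i # p) = bag_at (kids t ! i) p"

lemma Nil_in_pos: "[] \<in> pos t"
  by (cases t) (simp add: pos_Node)

lemma finite_pos: "finite (pos t)"
  by (induction t) (auto simp: pos_Node)

lemma card_pos: "card (pos t) = nodes t"
proof (induction t)
  case (Node X ts)
  have "card (\<Union>i<length ts. (#) i ` pos (ts ! i)) = (\<Sum>i<length ts. card ((#) i ` pos (ts ! i)))"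
    by (intro card_UN_disjoint) (auto simp: finite_pos)
  also have "\<dots> = (\<Sum>i<length ts. nodes (ts ! i))"
    by (intro sum.cong) (auto simp: card_image Node.IH)
  also have "\<dots> = sum_list (map nodes ts)"
    by (simp add: sum_list_sum_nth atLeast0LessThan)
  finally show ?case by (subst pos_Node, subst card_insert_disjoint) (auto simp: finite_pos)
qed

lemma bag_at_pos: "bag_at t ` pos t = bags t"
proof (induction t)
  case (Node X ts)
  have "bag_at (Node X ts) ` pos (Node X ts) = insert X (\<Union>i<length ts. bag_at (ts ! i) ` pos (ts ! i))"
    by (simp add: pos_Node image_UN image_image)
  also have "\<dots> = insert X (\<Union>i<length ts. bags (ts ! i))"
    using Node.IH by simp
  also have "(\<Union>i<length ts. bags (ts ! i)) = (\<Union>t \<in> set ts. bags t)"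
    by (auto simp: set_conv_nth)
  finally show ?case by simp
qed

lemma bag_at_subset: "p \<in> pos t \<Longrightarrow> bag_at t p \<subseteq> rverts t"
  using bag_at_pos[of t] bags_subset_rverts by blast

lemma butlast_in_pos: "p \<in> pos t \<Longrightarrow> butlast p \<in> pos t"
proof (induction t arbitrary: p)
  case (Node X ts)
  then show ?case by (cases p) (auto simp: pos_Node image_iff)
qed

lemma slick_bag_at:
  assumes "slick E t" "p \<in> pos t" "p \<noteq> []" "v \<in> bag_at t p" "v \<in> bag_at t (butlast p)"
  shows "E `` {v} \<inter> bag_at t p - bag_at t (butlast p) \<noteq> {}"
  using assms
proof (induction t arbitrary: p)
  case (Node X ts)
  then obtain i q where p: "p = i # q" "i < length ts" "q \<in> pos (ts ! i)"
    by (auto simp: pos_Node)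
  have "linked E X (ts ! i)" "slick E (ts ! i)" using Node.prems(1) p(2) by auto
  then show ?case
    using Node.IH[of "ts ! i" q] Node.prems p by (cases "q = []") (auto simp: linked_def)
qed

text \<open>If \<open>v\<close> is in the root bag, then by \<open>linked\<close> any child
  containing \<open>v\<close> has it in its own root bag, so no second top arises. Otherwise only
  one child contains \<open>v\<close>. This feeds \<open>top_connected\<close>.\<close>

lemma unique_top:
  assumes "slick E t" "v \<in> rverts t"
  shows "\<exists>!p. p \<in> pos t \<and> v \<in> bag_at t p \<and> (p = [] \<or> v \<notin> bag_at t (butlast p))"
  using assms
proof (induction t)
  case (Node X ts)
  let ?top = "\<lambda>t p. p \<in> pos t \<and> v \<in> bag_at t p \<and> (p = [] \<or> v \<notin> bag_at t (butlast p))"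
  have child: "linked E X (ts ! i)" "slick E (ts ! i)" if "i < length ts" for i
    using Node.prems(1) that by auto
  have IH: "\<exists>!p. ?top (ts ! i) p" if "i < length ts" "v \<in> rverts (ts ! i)" for i
    using Node.IH[of "ts ! i"] child that by auto
  have cons: "?top (Node X ts) (i # q) \<longleftrightarrow> i < length ts \<and> ?top (ts ! i) q \<and> (q = [] \<longrightarrow> v \<notin> X)" for i q
    by (auto simp: pos_Node)
  show ?case
  proof (cases "v \<in> X")
    case True
    have "\<not> ?top (Node X ts) (i # q)" for i q
    proof
      assume a: "?top (Node X ts) (i # q)"
      then have i: "i < length ts" "?top (ts ! i) q" "q \<noteq> []" using cons True by auto
      have "v \<in> rverts (ts ! i)" using i(2) bag_at_subset by blast
      moreover from this have "?top (ts ! i) []"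
        using child[OF i(1)] True Nil_in_pos by (auto simp: linked_def)
      ultimately show False using IH[OF i(1)] i(2,3) by blast
    qed
    moreover have "?top (Node X ts) []" using True by (simp add: pos_Node)
    ultimately show ?thesis by (metis list.exhaust)
  next
    case False
    then obtain i where i: "i < length ts" "v \<in> rverts (ts ! i)"
      using Node.prems(2) by (auto simp: in_set_conv_nth)
    have same: "j = i" if "j < length ts" "v \<in> rverts (ts ! j)" for j
    proof (rule ccontr)
      assume "j \<noteq> i"
      then have "rverts (ts ! i) \<inter> rverts (ts ! j) \<subseteq> X"
        using Node.prems(1) i that by (auto simp: sorted_wrt_iff_nth_less neq_iff)
      then show False using i that False by auto
    qed
    obtain q where q: "?top (ts ! i) q" "\<And>q'. ?top (ts ! i) q' \<Longrightarrow> q' = q" using IH[OF i] by blast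
    show ?thesis
    proof (rule ex1I)
      show "?top (Node X ts) (i # q)" using cons i(1) q(1) False by blast
      fix p assume p: "?top (Node X ts) p"
      show "p = i # q"
      proof (cases p)
        case Nil
        then show ?thesis using p False by simp
      next
        case (Cons j q')
        then have j: "j < length ts" "?top (ts ! j) q'" using p cons by blast+
        then have "v \<in> rverts (ts ! j)" using bag_at_subset by blast
        then show ?thesis using same j q(2) Cons by blast
      qed
    qed
  qed
qed

text \<open>Addresses are coded by natural numbers because the decomposition tree is to have nodes
  of type \<open>nat\<close>.\<close>

definition node_par :: "nat \<Rightarrow> nat" where
  "node_par x = to_nat (butlast (from_nat x :: nat list))"

definition tree_of :: "'a rose \<Rightarrow> nat pair_pre_digraph" where
  "tree_of t = (let N = to_nat ` pos t; R = N - {to_nat ([] :: nat list)} in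
     \<lparr>pverts = N, parcs = {(x, y). x \<in> R \<and> y = node_par x \<or> y \<in> R \<and> x = node_par y}\<rparr>)"

definition bag_of :: "'a rose \<Rightarrow> nat \<Rightarrow> 'a set" where
  "bag_of t x = bag_at t (from_nat x)"

lemma pverts_tree_of: "pverts (tree_of t) = to_nat ` pos t"
  by (simp add: tree_of_def Let_def)

lemma rooted_tree_of:
  "rooted_tree (tree_of t) (to_nat ([] :: nat list)) node_par (\<lambda>x. length (from_nat x :: nat list))"
proof
  show "parcs (tree_of t) = {(x, y). x \<in> pverts (tree_of t) - {to_nat ([] :: nat list)} \<and> y = node_par x \<or>
      y \<in> pverts (tree_of t) - {to_nat ([] :: nat list)} \<and> x = node_par y}"
    by (simp add: tree_of_def Let_def)
qed (auto simp: pverts_tree_of finite_pos Nil_in_pos node_par_def butlast_in_pos)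

lemma slick_tree_decomposition_of:
  assumes t: "slick (parcs G) t" "rverts t = pverts G" "covers (parcs G) t" and G: "pair_graph G"
  shows "slick_tree_decomposition G (tree_of t) (to_nat ([] :: nat list)) (bag_of t)"
proof -
  interpret rooted_tree "tree_of t" "to_nat ([] :: nat list)" node_par "\<lambda>x. length (from_nat x :: nat list)"
    by (rule rooted_tree_of)
  interpret G: pair_graph G by (rule G)
  have bags: "bag_of t ` pverts (tree_of t) = bags t"
    using bag_at_pos[of t] by (simp add: pverts_tree_of bag_of_def image_image)
  have "\<exists>x \<in> pverts (tree_of t). v \<in> bag_of t x \<and> w \<in> bag_of t x" if "(v, w) \<in> parcs G" for v w
  proof -
    have "\<exists>X \<in> bags t. v \<in> X \<and> w \<in> X"
      using coversD[OF t(3) that] G.wellformed'[OF that] t(2) by simp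
    then show ?thesis using bags by (metis image_iff)
  qed
  moreover have "bag_of t x \<subseteq> pverts G" if "x \<in> pverts (tree_of t)" for x
    using that bags bags_subset_rverts[of "bag_of t x" t] t(2) by blast
  moreover have "Digraph_Component.connected (with_proj (tree_of t) \<restriction> {x \<in> pverts (tree_of t). v \<in> bag_of t x})"
    if v: "v \<in> pverts G" for v
  proof (rule top_connected)
    let ?C = "{x \<in> pverts (tree_of t). v \<in> bag_of t x}"
    \<comment> \<open>Positions are closed under \<open>butlast\<close>, so a parent outside
      \<open>?C\<close> can only mean a parent bag without \<open>v\<close>.\<close>
    have top: "to_nat p \<in> ?C \<and> (to_nat p = to_nat ([] :: nat list) \<or> node_par (to_nat p) \<notin> ?C) \<longleftrightarrow>
        p \<in> pos t \<and> v \<in> bag_at t p \<and> (p = [] \<or> v \<notin> bag_at t (butlast p))" for p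
      using butlast_in_pos[of p t] by (auto simp: pverts_tree_of bag_of_def node_par_def inj_image_mem_iff)
    obtain p where p: "p \<in> pos t \<and> v \<in> bag_at t p \<and> (p = [] \<or> v \<notin> bag_at t (butlast p))"
      "\<And>q. q \<in> pos t \<and> v \<in> bag_at t q \<and> (q = [] \<or> v \<notin> bag_at t (butlast q)) \<Longrightarrow> q = p"
      using unique_top[OF t(1), of v] v t(2) by blast
    show "\<exists>!x. x \<in> ?C \<and> (x = to_nat ([] :: nat list) \<or> node_par x \<notin> ?C)"
    proof (rule ex1I)
      show "to_nat p \<in> ?C \<and> (to_nat p = to_nat ([] :: nat list) \<or> node_par (to_nat p) \<notin> ?C)"
        unfolding top by (rule p(1))
      fix x assume x: "x \<in> ?C \<and> (x = to_nat ([] :: nat list) \<or> node_par x \<notin> ?C)"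
      then obtain q :: "nat list" where q: "x = to_nat q" by (auto simp: pverts_tree_of)
      show "x = to_nat p" using x p(2)[of q] unfolding q top by blast
    qed
  qed simp
  ultimately have "tree_decomposition G (tree_of t) (bag_of t)"
    using undirected_tree by (auto simp: tree_decomposition_def)
  moreover have "(parcs G `` {v}) \<inter> bag_of t y - bag_of t x \<noteq> {}"
    if xy: "parent (tree_of t) (to_nat ([] :: nat list)) x y" and v: "v \<in> bag_of t x \<inter> bag_of t y" for x y v
  proof -
    have y: "y \<in> pverts (tree_of t) - {to_nat ([] :: nat list)}" "x = node_par y"
      using parent_eq_par[OF xy] by auto
    then obtain p where p: "p \<in> pos t" "y = to_nat p" "p \<noteq> []" by (auto simp: pverts_tree_of)
    show ?thesis
      using slick_bag_at[OF t(1) p(1,3), of v] v y(2) by (simp add: p(2) bag_of_def node_par_def)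
  qed
  ultimately show ?thesis
    using root_node by (auto simp: slick_tree_decomposition_def rooted_tree_decomposition_def)
qed

lemma decomposition_order_tree_of: "decomposition_order (tree_of t) = nodes t"
  by (simp add: decomposition_order_def pverts_tree_of card_image card_pos)

lemma decomposition_width_tree_of:
  assumes "\<And>X. X \<in> bags t \<Longrightarrow> card X \<le> m"
  shows "decomposition_width (tree_of t) (bag_of t) \<le> int m - 1"
proof -
  have "(MAX x \<in> pverts (tree_of t). int (card (bag_of t x))) \<le> int m"
    using assms bag_at_pos[of t] finite_pos[of t] Nil_in_pos[of t]
    by (subst Max_le_iff) (auto simp: pverts_tree_of bag_of_def)
  then show ?thesis by (simp add: decomposition_width_def)
qed

section \<open>Treewidth\<close>

lemma tree_decomposition_nodes:
  assumes "tree_decomposition G T B"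
  shows "finite (pverts T)" "pverts T \<noteq> {}"
proof -
  have T: "undirected_tree T" using assms by (simp add: tree_decomposition_def)
  then interpret pair_graph T by (simp add: undirected_tree_def)
  show "finite (pverts T)" by (rule pair_finite_verts)
  show "pverts T \<noteq> {}" using T by (auto simp: undirected_tree_def connected_def strongly_connected_def)
qed

lemma card_bag_le_width:
  assumes "tree_decomposition G T B" "x \<in> pverts T"
  shows "int (card (B x)) \<le> decomposition_width T B + 1"
  using assms(2) tree_decomposition_nodes[OF assms(1)] by (simp add: decomposition_width_def)

text \<open>\<open>LEAST\<close> over integers requires a lower bound. Widths are at least
  \<open>-1\<close>, so shifting by one reduces it to the least natural number; the one-bag
  decomposition shows existence.\<close>

lemma treewidth_attained:
  fixes G :: "'a pair_pre_digraph"
  assumes G: "pair_graph G"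
  obtains T :: "nat pair_pre_digraph" and B where
    "tree_decomposition G T B" "decomposition_width T B = treewidth G"
proof -
  let ?P = "\<lambda>w. \<exists>(T :: nat pair_pre_digraph) B. tree_decomposition G T B \<and> decomposition_width T B = w"
  have "slick_tree_decomposition G (tree_of (Node (pverts G) [])) (to_nat ([] :: nat list))
      (bag_of (Node (pverts G) []))"
    using G by (intro slick_tree_decomposition_of) (auto simp: covers_def)
  then obtain w where w: "?P w"
    by (auto simp: slick_tree_decomposition_def rooted_tree_decomposition_def)
  have lower: "-1 \<le> w" if "?P w" for w
  proof -
    from that obtain T :: "nat pair_pre_digraph" and B
      where T: "tree_decomposition G T B" "decomposition_width T B = w" by blast
    then obtain x where "x \<in> pverts T" using tree_decomposition_nodes[OF T(1)] by blast
    then show ?thesis using card_bag_le_width[OF T(1)] T(2) by fastforce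
  qed
  define n where "n = (LEAST n. ?P (int n - 1))"
  have "?P (int (nat (w + 1)) - 1)" using w lower[OF w] by simp
  then have n: "?P (int n - 1)" unfolding n_def by (rule LeastI)
  have "treewidth G = int n - 1"
    unfolding treewidth_def
  proof (rule Least_equality)
    show "?P (int n - 1)" by (rule n)
    fix y assume y: "?P y"
    then have "?P (int (nat (y + 1)) - 1)" using lower[OF y] by simp
    then have "n \<le> nat (y + 1)" unfolding n_def by (rule Least_le)
    then show "int n - 1 \<le> y" using lower[OF y] by linarith
  qed
  then show ?thesis using n that by metis
qed

theorem theorem28:
  fixes G :: "'a pair_pre_digraph" and k :: int
  assumes "pair_graph G"
    and "k \<ge> treewidth G"
  shows "\<exists>(T :: nat pair_pre_digraph) r B.
           slick_tree_decomposition G T r B \<and>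
           decomposition_width T B \<le> 56 * k + 58 \<and>
           real (decomposition_order T) \<le> max (real (card (pverts G)) / real_of_int (14 * k + 14)) 1"
proof -
  interpret G: pair_graph G by (rule assms(1))
  obtain T :: "nat pair_pre_digraph" and B where
    td: "tree_decomposition G T B" and width: "decomposition_width T B = treewidth G"
    using treewidth_attained[OF assms(1)] .
  define K where "K = nat (k + 1)"
  have bag: "int (card (B x)) \<le> k + 1" if "x \<in> pverts T" for x
    using card_bag_le_width[OF td that] width assms(2) by linarith
  obtain x0 where "x0 \<in> pverts T" using tree_decomposition_nodes[OF td] by blast
  then have K: "int K = k + 1" using bag[of x0] by (simp add: K_def)
  have fin: "finite (pverts G)" by (rule G.pair_finite_verts)
  have fin_bag: "finite (B x)" if "x \<in> pverts T" for x
    using td that finite_subset[OF _ fin] by (simp add: tree_decomposition_def)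
  \<comment> \<open>\<open>0 < K\<close> is recorded in the second alternative for the later
    division by \<open>14 * K\<close>; for \<open>k = -1\<close> a single node remains.\<close>
  have "\<exists>t. slick (parcs G) t \<and> rverts t = pverts G \<and> covers (parcs G) t \<and>
      (\<forall>X \<in> bags t. card X \<le> 53 * K) \<and> (nodes t = 1 \<or> 14 * K * nodes t \<le> card (pverts G) \<and> 0 < K)"
  proof (cases "card (pverts G) \<le> 14 * K")
    case True
    then show ?thesis by (intro exI[of _ "Node (pverts G) []"]) (auto simp: covers_def)
  next
    case False
    have "0 < K"
    proof (rule ccontr)
      assume "\<not> 0 < K"
      \<comment> \<open>With \<open>K = 0\<close> all bags are empty, so the graph has no
        vertices.\<close>
      then have "B x = {}" if "x \<in> pverts T" for x
        using bag[OF that] fin_bag[OF that] K by simp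
      moreover have "{x \<in> pverts T. v \<in> B x} \<noteq> {}" if "v \<in> pverts G" for v
        using td that by (auto simp: tree_decomposition_def connected_def strongly_connected_def)
      ultimately have "pverts G = {}" by blast
      then show False using False by simp
    qed
    have "balanced_separable (parcs G) (pverts G) K TYPE(nat set)"
      unfolding balanced_separable_def
    proof (intro allI impI)
      fix S assume "S \<subseteq> pverts G"
      then obtain x and lab :: "'a \<Rightarrow> nat set" where x: "x \<in> pverts T"
        "\<And>v w. (v, w) \<in> parcs G \<Longrightarrow> v \<in> pverts G - B x \<Longrightarrow> w \<in> pverts G - B x \<Longrightarrow> lab v = lab w"
        "\<And>L. 2 * card {v \<in> S - B x. lab v = L} \<le> card S"
        using balanced_bag[OF td _ fin] by metis
      then show "\<exists>X (lab :: 'a \<Rightarrow> nat set). finite X \<and> card X \<le> K \<and>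
          (\<forall>v \<in> pverts G - X. \<forall>w \<in> pverts G - X. (v, w) \<in> parcs G \<longrightarrow> lab v = lab w) \<and>
          (\<forall>L. 2 * card {v \<in> S - X. lab v = L} \<le> card S)"
        using fin_bag bag[OF x(1)] K by (intro exI[of _ "B x"] exI[of _ lab]) auto
    qed
    moreover have "sym (parcs G)" using G.arcs_symmetric by (auto simp: sym_def)
    ultimately show ?thesis
      using small_order_exists[of "parcs G" "pverts G" K] fin \<open>0 < K\<close> False by auto
  qed
  then obtain t where t: "slick (parcs G) t" "rverts t = pverts G" "covers (parcs G) t"
    "\<And>X. X \<in> bags t \<Longrightarrow> card X \<le> 53 * K" "nodes t = 1 \<or> 14 * K * nodes t \<le> card (pverts G) \<and> 0 < K"
    by blast
  \<comment> \<open>The width is at most \<open>53 * K - 1 = 53 * k + 52\<close>, which is within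
    the bound because \<open>k \<ge> -1\<close>.\<close>
  have "decomposition_width (tree_of t) (bag_of t) \<le> 56 * k + 58"
    using decomposition_width_tree_of[of t "53 * K"] t(4) K by simp
  moreover have "real (nodes t) \<le> max (real (card (pverts G)) / real_of_int (14 * k + 14)) 1"
    using t(5)
  proof
    assume *: "14 * K * nodes t \<le> card (pverts G) \<and> 0 < K"
    have "real_of_int (14 * k + 14) = real (14 * K)" using K by linarith
    moreover have "real (nodes t) * real (14 * K) \<le> real (card (pverts G))"
      using * by (metis mult.commute of_nat_le_iff of_nat_mult)
    ultimately have "real (nodes t) \<le> real (card (pverts G)) / real_of_int (14 * k + 14)"
      using * by (simp add: pos_le_divide_eq)
    then show ?thesis by linarith
  qed simp
  ultimately show ?thesis
    using slick_tree_decomposition_of[OF t(1-3) assms(1)]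
    by (intro exI[of _ "tree_of t"] exI[of _ "to_nat ([] :: nat list)"] exI[of _ "bag_of t"])
      (simp add: decomposition_order_tree_of)
qed

end
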